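(* Let $k$ be an infinite field and $\Delta$ a connected, pure $(d-1)$-dimensional $k$-homology manifold ($d\ge4$) with $n$ vertices. If for at least $n-d$ of the vertices $v$ of $\Delta$, $L^i_s(\operatorname{lk}v)\neq\emptyset$, then $L^{i+1}_s(\Delta)\neq\emptyset$.
   Context: For a simplicial complex $\Gamma$ of dimension $e-1$ on vertices $v_1,\dots,v_N$, $R=k[x_1,\dots,x_N]$ and the face ring is $k[\Gamma]=R/I_\Gamma$, where $I_\Gamma$ is generated by monomials $x_{i_1}\cdots x_{i_r}$ with $\{v_{i_1},\dots,v_{i_r}\}\notin\Gamma$. A set $\Theta=\{\theta_1,\dots,\theta_e\}$ of linear forms $\theta_i=\sum_j\theta_{i,j}x_j$ is a linear system of parameters (l.s.o.p.) for $k[\Gamma]$ if for each facet $\sigma$, the $e\times e$ matrix $(\theta_{i,j})_{v_j\in\sigma}$ has rank $e$. $L^i_s(\Gamma)$ is the set of pairs $(\omega,\Theta)$ with $\omega\in R$ a linear form and $\Theta$ an l.s.o.p. for $k[\Gamma]$ such that multiplication $\omega:(k[\Gamma]/\langle\Theta\rangle)_i\to(k[\Gamma]/\langle\Theta\rangle)_{i+1}$ is surjective. The link of $v$ is $\operatorname{lk}v=\{\tau: v\notin\tau,\tau\cup\{v\}\in\Delta\}$. $k$-homology manifold: every nonempty face's link has the $k$-homology of a sphere or ball of dimension $d-|\rho|-1$. *)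

theory Defs
  imports
    "HOL-Library.Poly_Mapping"
    "HOL-Algebra.QuotRing"
    "Jordan_Normal_Form.DL_Rank"
begin

section \<open>Simplicial complexes\<close>

definition simplicial_complex :: "'v set set \<Rightarrow> bool" where
  "simplicial_complex \<Gamma> \<longleftrightarrow>
     finite \<Gamma> \<and> {} \<in> \<Gamma> \<and> (\<forall>\<sigma>\<in>\<Gamma>. finite \<sigma> \<and> (\<forall>\<tau>\<subseteq>\<sigma>. \<tau> \<in> \<Gamma>))"

definition vertices :: "'v set set \<Rightarrow> 'v set" where
  "vertices \<Gamma> = \<Union>\<Gamma>"

definition facets :: "'v set set \<Rightarrow> 'v set set" where
  "facets \<Gamma> = {\<sigma> \<in> \<Gamma>. \<forall>\<tau>\<in>\<Gamma>. \<sigma> \<subseteq> \<tau> \<longrightarrow> \<tau> = \<sigma>}"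

definition complex_dim :: "'v set set \<Rightarrow> int" where
  "complex_dim \<Gamma> = int (Max (card ` \<Gamma>)) - 1"

definition pure_complex :: "'v set set \<Rightarrow> bool" where
  "pure_complex \<Gamma> \<longleftrightarrow> (\<forall>\<sigma>\<in>facets \<Gamma>. int (card \<sigma>) - 1 = complex_dim \<Gamma>)"

definition connected_complex :: "'v set set \<Rightarrow> bool" where
  "connected_complex \<Gamma> \<longleftrightarrow>
     (\<forall>u\<in>vertices \<Gamma>. \<forall>w\<in>vertices \<Gamma>. (u, w) \<in> {(x, y). {x, y} \<in> \<Gamma>}\<^sup>*)"

definition link :: "'v set set \<Rightarrow> 'v set \<Rightarrow> 'v set set" where
  "link \<Gamma> \<rho> = {\<tau>. \<tau> \<inter> \<rho> = {} \<and> \<tau> \<union> \<rho> \<in> \<Gamma>}"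

section \<open>Reduced simplicial homology with field coefficients\<close>

text \<open>Faces are oriented by the linear order on the vertices.  The empty face is the basis of the
  chains of degree -1, so the homology is reduced.\<close>

definition chains :: "'v set set \<Rightarrow> int \<Rightarrow> ('v set \<Rightarrow>\<^sub>0 'k::field) set" where
  "chains \<Gamma> p = {c. \<forall>\<sigma>\<in>Poly_Mapping.keys c. \<sigma> \<in> \<Gamma> \<and> int (card \<sigma>) = p + 1}"

definition boundary :: "('v::linorder set \<Rightarrow>\<^sub>0 'k::field) \<Rightarrow> ('v set \<Rightarrow>\<^sub>0 'k)" where
  "boundary c = (\<Sum>\<sigma>\<in>Poly_Mapping.keys c. \<Sum>v\<in>\<sigma>.
      Poly_Mapping.single (\<sigma> - {v}) ((-1) ^ card {w\<in>\<sigma>. w < v} * Poly_Mapping.lookup c \<sigma>))"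

definition cycles :: "'v::linorder set set \<Rightarrow> int \<Rightarrow> ('v set \<Rightarrow>\<^sub>0 'k::field) set" where
  "cycles \<Gamma> p = {c \<in> chains \<Gamma> p. boundary c = 0}"

definition boundaries :: "'v::linorder set set \<Rightarrow> int \<Rightarrow> ('v set \<Rightarrow>\<^sub>0 'k::field) set" where
  "boundaries \<Gamma> p = boundary ` chains \<Gamma> (p + 1)"

definition chain_scale :: "'k::field \<Rightarrow> ('v set \<Rightarrow>\<^sub>0 'k) \<Rightarrow> ('v set \<Rightarrow>\<^sub>0 'k)" where
  "chain_scale a c = Poly_Mapping.map ((*) a) c"

lemma lookup_chain_scale:
  "Poly_Mapping.lookup (chain_scale a c) \<sigma> = a * Poly_Mapping.lookup c \<sigma>"
  by (simp add: chain_scale_def Poly_Mapping.map.rep_eq when_def)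

lemma vector_space_chain_scale:
  "vector_space (chain_scale :: 'k::field \<Rightarrow> ('v set \<Rightarrow>\<^sub>0 'k) \<Rightarrow> _)"
  by unfold_locales
    (auto intro!: poly_mapping_eqI simp: lookup_chain_scale lookup_add algebra_simps)

text \<open>The dimension over \<open>'k\<close> of the reduced homology in degree \<open>p\<close>.  On the
  finite-dimensional chain spaces of a finite complex the truncated subtraction is exact.\<close>

definition reduced_betti :: "'k::field itself \<Rightarrow> 'v::linorder set set \<Rightarrow> int \<Rightarrow> nat" where
  "reduced_betti _ \<Gamma> p =
     vector_space.dim chain_scale (cycles \<Gamma> p :: ('v set \<Rightarrow>\<^sub>0 'k) set)
   - vector_space.dim chain_scale (boundaries \<Gamma> p :: ('v set \<Rightarrow>\<^sub>0 'k) set)"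

definition homology_of_sphere :: "'k::field itself \<Rightarrow> int \<Rightarrow> 'v::linorder set set \<Rightarrow> bool" where
  "homology_of_sphere K q \<Gamma> \<longleftrightarrow> (\<forall>p. reduced_betti K \<Gamma> p = (if p = q then 1 else 0))"

text \<open>There is no ball of dimension -1.\<close>

definition homology_of_ball :: "'k::field itself \<Rightarrow> int \<Rightarrow> 'v::linorder set set \<Rightarrow> bool" where
  "homology_of_ball K q \<Gamma> \<longleftrightarrow> 0 \<le> q \<and> (\<forall>p. reduced_betti K \<Gamma> p = 0)"

definition homology_manifold :: "'k::field itself \<Rightarrow> 'v::linorder set set \<Rightarrow> bool" where
  "homology_manifold K \<Delta> \<longleftrightarrow>
     (\<forall>\<rho>\<in>\<Delta>. \<rho> \<noteq> {} \<longrightarrow>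
        homology_of_sphere K (complex_dim \<Delta> - int (card \<rho>)) (link \<Delta> \<rho>) \<or>
        homology_of_ball K (complex_dim \<Delta> - int (card \<rho>)) (link \<Delta> \<rho>))"

section \<open>Face rings\<close>

type_synonym ('v, 'k) mpoly = "('v \<Rightarrow>\<^sub>0 nat) \<Rightarrow>\<^sub>0 'k"

definition indet :: "'v \<Rightarrow> ('v, 'k::field) mpoly" where
  "indet v = Poly_Mapping.single (Poly_Mapping.single v 1) 1"

definition polys_in :: "'v set \<Rightarrow> ('v, 'k::field) mpoly set" where
  "polys_in V = {f. \<forall>m\<in>Poly_Mapping.keys f. Poly_Mapping.keys m \<subseteq> V}"

definition homogeneous :: "'v set \<Rightarrow> nat \<Rightarrow> ('v, 'k::field) mpoly set" where
  "homogeneous V i = {f \<in> polys_in V. \<forall>m\<in>Poly_Mapping.keys f. (\<Sum>v\<in>Poly_Mapping.keys m. Poly_Mapping.lookup m v) = i}"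

definition poly_ring :: "'v set \<Rightarrow> ('v, 'k::field) mpoly ring" where
  "poly_ring V = \<lparr>carrier = polys_in V, monoid.mult = (*), one = 1, zero = 0, add = (+)\<rparr>"

definition face_ideal :: "'v set set \<Rightarrow> ('v, 'k::field) mpoly set" where
  "face_ideal \<Gamma> =
     genideal (poly_ring (vertices \<Gamma>)) {\<Prod>v\<in>\<sigma>. indet v | \<sigma>. \<sigma> \<subseteq> vertices \<Gamma> \<and> \<sigma> \<notin> \<Gamma>}"

definition face_ring :: "'v set set \<Rightarrow> ('v, 'k::field) mpoly set ring" where
  "face_ring \<Gamma> = poly_ring (vertices \<Gamma>) Quot face_ideal \<Gamma>"

definition face_class :: "'v set set \<Rightarrow> ('v, 'k::field) mpoly \<Rightarrow> ('v, 'k) mpoly set" where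
  "face_class \<Gamma> f = face_ideal \<Gamma> +>\<^bsub>poly_ring (vertices \<Gamma>)\<^esub> f"

definition param_ideal ::
  "'v set set \<Rightarrow> ('v, 'k::field) mpoly list \<Rightarrow> ('v, 'k) mpoly set set" where
  "param_ideal \<Gamma> \<Theta> = genideal (face_ring \<Gamma>) (face_class \<Gamma> ` set \<Theta>)"

definition quotient_ring ::
  "'v set set \<Rightarrow> ('v, 'k::field) mpoly list \<Rightarrow> ('v, 'k) mpoly set set ring" where
  "quotient_ring \<Gamma> \<Theta> = face_ring \<Gamma> Quot param_ideal \<Gamma> \<Theta>"

definition quotient_class ::
  "'v set set \<Rightarrow> ('v, 'k::field) mpoly list \<Rightarrow> ('v, 'k) mpoly \<Rightarrow> ('v, 'k) mpoly set set" where
  "quotient_class \<Gamma> \<Theta> f = param_ideal \<Gamma> \<Theta> +>\<^bsub>face_ring \<Gamma>\<^esub> face_class \<Gamma> f"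

definition quotient_part ::
  "'v set set \<Rightarrow> ('v, 'k::field) mpoly list \<Rightarrow> nat \<Rightarrow> ('v, 'k) mpoly set set set" where
  "quotient_part \<Gamma> \<Theta> i = quotient_class \<Gamma> \<Theta> ` homogeneous (vertices \<Gamma>) i"

section \<open>Linear systems of parameters and surjective multiplication\<close>

text \<open>The columns of the coefficient matrix are the vertices of \<open>\<sigma>\<close> in increasing order.\<close>

definition coeff_matrix ::
  "('v::linorder, 'k::field) mpoly list \<Rightarrow> 'v set \<Rightarrow> 'k mat" where
  "coeff_matrix \<Theta> \<sigma> = mat (length \<Theta>) (card \<sigma>)
     (\<lambda>(i, j). Poly_Mapping.lookup (\<Theta> ! i) (Poly_Mapping.single (sorted_list_of_set \<sigma> ! j) 1))"

definition lsop :: "'v::linorder set set \<Rightarrow> ('v, 'k::field) mpoly list \<Rightarrow> bool" where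
  "lsop \<Gamma> \<Theta> \<longleftrightarrow>
     int (length \<Theta>) = complex_dim \<Gamma> + 1 \<and>
     set \<Theta> \<subseteq> homogeneous (vertices \<Gamma>) 1 \<and>
     (\<forall>\<sigma>\<in>facets \<Gamma>. vec_space.rank (length \<Theta>) (coeff_matrix \<Theta> \<sigma>) = length \<Theta>)"

definition L_s ::
  "nat \<Rightarrow> 'v::linorder set set \<Rightarrow> (('v, 'k::field) mpoly \<times> ('v, 'k) mpoly list) set" where
  "L_s i \<Gamma> = {(\<omega>, \<Theta>). \<omega> \<in> homogeneous (vertices \<Gamma>) 1 \<and> lsop \<Gamma> \<Theta> \<and>
     (\<lambda>a. quotient_class \<Gamma> \<Theta> \<omega> \<otimes>\<^bsub>quotient_ring \<Gamma> \<Theta>\<^esub> a) ` quotient_part \<Gamma> \<Theta> i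
       = quotient_part \<Gamma> \<Theta> (i + 1)}"

end

theory Submission
  imports Defs
begin

text \<open>Write \<open>A\<close> for the face ring of \<open>\<Delta>\<close> modulo \<open>d + 1\<close> linear forms \<open>\<Theta>, \<omega>\<close>; the claim is that
  \<open>A\<close> vanishes in degree \<open>i + 2\<close> for a suitable choice.  The ideal generated by a vertex variable
  \<open>x\<^sub>v\<close> in \<open>A\<close> is a quotient of the face ring of the star of \<open>v\<close> modulo \<open>\<Theta>, \<omega>\<close>, which is
  the face ring of the link modulo \<open>d\<close> linear forms.  So if \<open>L_s i\<close> of the link is nonempty,
  generic forms make \<open>x\<^sub>v\<close> annihilate degree \<open>i + 1\<close> of \<open>A\<close>.  There are at most \<open>d\<close> other vertices,
  and modulo \<open>d + 1\<close> generic linear forms their variables are combinations of the annihilating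
  ones.  Genericity is handled by restriction to lines: each condition says that a matrix
  depending affinely on the forms has a one-sided inverse, so if it holds somewhere on a line,
  then it fails at only finitely many points of that line.\<close>

section \<open>Matrices depending affinely on a parameter\<close>

text \<open>The determinant of I + t B is a polynomial in t with value 1 at t = 0. Hence it is
  nonzero and has finitely many roots, and away from these the matrix has a left inverse
  \<open>D\<close>.\<close>

lemma finite_singular_parameters:
  fixes B :: "'s \<Rightarrow> 's \<Rightarrow> 'k::field"
  assumes "finite S"
  shows "finite {t. \<not> (\<exists>D. \<forall>r\<in>S. \<forall>s'\<in>S.
    (\<Sum>s\<in>S. D r s * ((if s = s' then 1 else 0) + t * B s s')) = (if r = s' then 1 else 0))}"
proof -
  obtain e where e: "bij_betw e {0..<card S} S"
    using ex_bij_betw_nat_finite[OF assms] by blast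
  define n where "n = card S"
  define M where "M t = mat n n (\<lambda>(i, j). (if i = j then 1 else 0) + t * B (e i) (e j))" for t
  \<comment> \<open>The same matrix over the polynomial ring in t. Evaluation at t is a ring
    homomorphism and so commutes with \<open>det\<close>.\<close>
  define P where "P = mat n n (\<lambda>(i, j). [:if i = j then 1 else 0, B (e i) (e j):])"
  define idx where "idx = inv_into {0..<n} e"
  have idx: "idx s < n" "e (idx s) = s" if "s \<in> S" for s
    using e that bij_betw_inv_into_right[OF e that] bij_betwE[OF bij_betw_inv_into[OF e]]
    unfolding idx_def n_def by auto
  have inj: "e i = e j \<longleftrightarrow> i = j" if "i < n" "j < n" for i j
    using e that unfolding n_def bij_betw_def inj_on_def by auto
  have M: "M t \<in> carrier_mat n n" for t unfolding M_def by simp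
  have det: "det (M t) = poly (det P) t" for t
  proof -
    interpret comm_ring_hom "\<lambda>p. poly p t" by unfold_locales auto
    have "M t = map_mat (\<lambda>p. poly p t) P"
      unfolding M_def P_def by (intro eq_matI) auto
    then show ?thesis by simp
  qed
  have "M 0 = 1\<^sub>m n" unfolding M_def by (intro eq_matI) auto
  then have "poly (det P) 0 = 1" using det[of 0] by simp
  then have "det P \<noteq> 0" by force
  then have fin: "finite {t. poly (det P) t = 0}" by (rule poly_roots_finite)
  show ?thesis
  proof (rule finite_subset[OF _ fin], clarify, rule ccontr)
    fix t
    assume no: "\<not> (\<exists>D. \<forall>r\<in>S. \<forall>s'\<in>S.
      (\<Sum>s\<in>S. D r s * ((if s = s' then 1 else 0) + t * B s s')) = (if r = s' then 1 else 0))"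
      and "poly (det P) t \<noteq> 0"
    then have "det (M t) \<noteq> 0" using det by simp
    then obtain C where C: "C \<in> carrier_mat n n" "C * M t = 1\<^sub>m n"
      using det_non_zero_imp_unit[OF M] unfolding Units_def ring_mat_def by auto
    define D where "D r s = C $$ (idx r, idx s)" for r s
    have "(\<Sum>s\<in>S. D r s * ((if s = s' then 1 else 0) + t * B s s')) = (if r = s' then 1 else 0)"
      if r: "r \<in> S" and s': "s' \<in> S" for r s'
    proof -
      have idxe: "idx (e j) = j" if "j < n" for j
        using that e idx(1)[of "e j"] idx(2)[of "e j"] inj unfolding n_def
        by (metis atLeastLessThan_iff bij_betwE le0)
      have "(\<Sum>s\<in>S. D r s * ((if s = s' then 1 else 0) + t * B s s'))
        = (\<Sum>j\<in>{0..<n}. D r (e j) * ((if e j = s' then 1 else 0) + t * B (e j) s'))"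
        unfolding n_def by (rule sum.reindex_bij_betw[OF e, symmetric])
      also have "\<dots> = (\<Sum>j\<in>{0..<n}. C $$ (idx r, j) * M t $$ (j, idx s'))"
      proof (rule sum.cong[OF refl])
        fix j assume "j \<in> {0..<n}"
        then have "j < n" "e j = s' \<longleftrightarrow> j = idx s'"
          using inj[of j "idx s'"] idx[OF s'] by auto
        then show "D r (e j) * ((if e j = s' then 1 else 0) + t * B (e j) s')
            = C $$ (idx r, j) * M t $$ (j, idx s')"
          using idx[OF s'] idxe by (simp add: D_def M_def)
      qed
      also have "\<dots> = (C * M t) $$ (idx r, idx s')"
        using idx[OF r] idx[OF s'] C(1) M[of t]
        by (simp add: scalar_prod_def)
      also have "\<dots> = (if r = s' then 1 else 0)"
        using idx(1)[OF r] idx(1)[OF s'] inj[of "idx r" "idx s'"] idx(2)[OF r] idx(2)[OF s']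
        by (simp add: C(2))
      finally show ?thesis .
    qed
    then show False using no by blast
  qed
qed

section \<open>Graded components of polynomials\<close>

lemma polys_in_iff: "f \<in> polys_in V \<longleftrightarrow> (\<forall>m. Poly_Mapping.lookup f m \<noteq> 0 \<longrightarrow> Poly_Mapping.keys m \<subseteq> V)"
  by (auto simp: polys_in_def in_keys_iff)

lemma keys_add_nat:
  "Poly_Mapping.keys (a + b) = Poly_Mapping.keys a \<union> Poly_Mapping.keys (b :: 'v \<Rightarrow>\<^sub>0 nat)"
  by (auto simp: in_keys_iff lookup_add)

definition mdeg :: "('v \<Rightarrow>\<^sub>0 nat) \<Rightarrow> nat" where
  "mdeg m = (\<Sum>v\<in>Poly_Mapping.keys m. Poly_Mapping.lookup m v)"

lemma mdeg_single [simp]: "mdeg (Poly_Mapping.single u k) = k"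
  by (simp add: mdeg_def)

lemma mdeg_superset:
  assumes "finite A" "Poly_Mapping.keys m \<subseteq> A"
  shows "mdeg m = (\<Sum>v\<in>A. Poly_Mapping.lookup m v)"
  unfolding mdeg_def using assms by (intro sum.mono_neutral_left) (auto simp: in_keys_iff)

lemma mdeg_add: "mdeg (a + b) = mdeg a + mdeg b"
proof -
  let ?A = "Poly_Mapping.keys a \<union> Poly_Mapping.keys b"
  show ?thesis
    using mdeg_superset[of ?A "a + b"] mdeg_superset[of ?A a] mdeg_superset[of ?A b]
    by (simp add: keys_add_nat lookup_add sum.distrib)
qed

lemma mdeg_Suc_split:
  assumes "mdeg m = Suc k"
  obtains u m' where "m = Poly_Mapping.single u 1 + m'" "mdeg m' = k"
proof -
  obtain u where u: "u \<in> Poly_Mapping.keys m"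
    using assms unfolding mdeg_def by fastforce
  have m: "m = Poly_Mapping.single u 1 + (m - Poly_Mapping.single u 1)"
    using u by (intro poly_mapping_eqI) (auto simp: lookup_add lookup_minus lookup_single when_def in_keys_iff)
  then have "mdeg (m - Poly_Mapping.single u 1) = k"
    using assms mdeg_add[of "Poly_Mapping.single u 1" "m - Poly_Mapping.single u 1"] by simp
  with m show ?thesis using that by blast
qed

lemma mdeg_0: "mdeg m = 0 \<Longrightarrow> m = 0"
  unfolding mdeg_def by (intro poly_mapping_eqI) (auto simp: in_keys_iff)

lemma mdeg_1:
  assumes "mdeg m = 1" obtains u where "m = Poly_Mapping.single u 1"
proof -
  obtain u m' where "m = Poly_Mapping.single u 1 + m'" "mdeg m' = 0"
    using mdeg_Suc_split[of m 0] assms unfolding One_nat_def by blast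
  then show ?thesis using that[of u] mdeg_0[of m'] by simp
qed

lemma homogeneous_iff:
  "f \<in> homogeneous V i \<longleftrightarrow>
    (\<forall>m. Poly_Mapping.lookup f m \<noteq> 0 \<longrightarrow> Poly_Mapping.keys m \<subseteq> V \<and> mdeg m = i)"
  by (auto simp: homogeneous_def polys_in_def in_keys_iff mdeg_def)

lemma homogeneous_subset_polys_in: "homogeneous V i \<subseteq> polys_in V"
  by (simp add: homogeneous_def)

lemma homogeneous_mono: "V \<subseteq> W \<Longrightarrow> homogeneous V i \<subseteq> homogeneous W i"
  by (fastforce simp: homogeneous_iff)

lemma homogeneous_add: "f \<in> homogeneous V i \<Longrightarrow> g \<in> homogeneous V i \<Longrightarrow> f + g \<in> homogeneous V i"
  using Poly_Mapping.keys_add[of f g] by (fastforce simp: homogeneous_def polys_in_def)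

lemma homogeneous_mult: "f \<in> homogeneous V i \<Longrightarrow> g \<in> homogeneous V j \<Longrightarrow> f * g \<in> homogeneous V (i + j)"
proof -
  assume f: "f \<in> homogeneous V i" and g: "g \<in> homogeneous V j"
  show ?thesis unfolding homogeneous_iff
  proof (intro allI impI)
    fix m assume "Poly_Mapping.lookup (f * g) m \<noteq> 0"
    then obtain a b where "m = a + b" "Poly_Mapping.lookup f a \<noteq> 0" "Poly_Mapping.lookup g b \<noteq> 0"
      using keys_mult[of f g] by (auto simp: in_keys_iff)
    with f g show "Poly_Mapping.keys m \<subseteq> V \<and> mdeg m = i + j"
      by (simp add: homogeneous_iff keys_add_nat mdeg_add)
  qed
qed

lemma homogeneous_0 [simp]: "0 \<in> homogeneous V i"
  by (simp add: homogeneous_iff)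

lemma homogeneous_single:
  "Poly_Mapping.keys m \<subseteq> V \<Longrightarrow> mdeg m = i \<Longrightarrow> Poly_Mapping.single m c \<in> homogeneous V i"
  by (auto simp: homogeneous_iff lookup_single when_def)

lemma indet_homogeneous: "v \<in> V \<Longrightarrow> indet v \<in> homogeneous V 1"
  unfolding indet_def by (intro homogeneous_single) auto

text \<open>The cofactors in \<open>spans\<close> and \<open>forms_ideal\<close> range over all
  polynomials. Cutting back to the variables in \<open>V\<close> and to one degree at the same time
  makes them homogeneous over the vertex set.\<close>

definition component :: "'v set \<Rightarrow> nat \<Rightarrow> ('v, 'k::field) mpoly \<Rightarrow> ('v, 'k) mpoly" where
  "component V k f =
     Abs_poly_mapping (\<lambda>m. if Poly_Mapping.keys m \<subseteq> V \<and> mdeg m = k then Poly_Mapping.lookup f m else 0)"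

lemma lookup_component:
  "Poly_Mapping.lookup (component V k f) m =
     (if Poly_Mapping.keys m \<subseteq> V \<and> mdeg m = k then Poly_Mapping.lookup f m else 0)"
proof -
  have "finite {m. (if Poly_Mapping.keys m \<subseteq> V \<and> mdeg m = k then Poly_Mapping.lookup f m else 0) \<noteq> 0}"
    by (rule finite_subset[OF _ finite_keys[of f]]) (auto simp: in_keys_iff)
  then show ?thesis unfolding component_def by simp
qed

lemma component_homogeneous: "component V k f \<in> homogeneous V k"
  by (simp add: homogeneous_iff lookup_component)

lemma component_id: "f \<in> homogeneous V k \<Longrightarrow> component V k f = f"
  by (rule poly_mapping_eqI) (auto simp: homogeneous_iff lookup_component)

lemma component_add: "component V k (f + g) = component V k f + component V k g"
  by (rule poly_mapping_eqI) (simp add: lookup_component lookup_add)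

lemma component_sum: "component V k (\<Sum>j\<in>J. f j) = (\<Sum>j\<in>J. component V k (f j))"
proof (rule poly_mapping_eqI)
  fix m show "Poly_Mapping.lookup (component V k (\<Sum>j\<in>J. f j)) m =
      Poly_Mapping.lookup (\<Sum>j\<in>J. component V k (f j)) m"
    unfolding lookup_component lookup_sum
    by (cases "Poly_Mapping.keys m \<subseteq> V \<and> mdeg m = k")
      (simp_all only: if_True if_False simp_thms sum.neutral_const)
qed

text \<open>Every monomial of \<open>l\<close> has degree 1, so a monomial of \<open>l * h\<close>
  over \<open>V\<close> of degree \<open>Suc k\<close> can only come from a monomial of
  \<open>h\<close> over \<open>V\<close> of degree \<open>k\<close>. The rest \<open>r\<close> of
  \<open>h\<close> contributes nothing.\<close>

lemma component_mult:
  assumes "l \<in> homogeneous V 1"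
  shows "component V (Suc k) (l * h) = l * component V k h"
proof -
  define r where "r = h - component V k h"
  have "Poly_Mapping.lookup (l * r) m = 0" if m: "Poly_Mapping.keys m \<subseteq> V" "mdeg m = Suc k" for m
  proof (rule ccontr)
    assume "Poly_Mapping.lookup (l * r) m \<noteq> 0"
    then obtain a b where ab: "m = a + b" "a \<in> Poly_Mapping.keys l" "b \<in> Poly_Mapping.keys r"
      using keys_mult[of l r] by (auto simp: in_keys_iff)
    have "mdeg a = 1" using assms ab(2) by (auto simp: homogeneous_iff in_keys_iff)
    then have "mdeg b = k" "Poly_Mapping.keys b \<subseteq> V"
      using m ab(1) by (auto simp: mdeg_add keys_add_nat)
    then have "Poly_Mapping.lookup r b = 0"
      by (simp add: r_def lookup_minus lookup_component)
    then show False using ab(3) by (simp add: in_keys_iff)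
  qed
  then have "component V (Suc k) (l * r) = 0"
    by (intro poly_mapping_eqI) (simp add: lookup_component)
  moreover have "l * h = l * component V k h + l * r"
    by (simp add: r_def algebra_simps)
  moreover have "l * component V k h \<in> homogeneous V (Suc k)"
    using homogeneous_mult[OF assms component_homogeneous] by simp
  ultimately show ?thesis by (simp add: component_add component_id)
qed

lemma sum_monomials:
  fixes f :: "('v, 'k::field) mpoly"
  shows "f = (\<Sum>m\<in>Poly_Mapping.keys f. Poly_Mapping.single m (Poly_Mapping.lookup f m))"
proof (rule poly_mapping_eqI)
  fix m
  have "(\<Sum>x\<in>Poly_Mapping.keys f. Poly_Mapping.lookup (Poly_Mapping.single x (Poly_Mapping.lookup f x)) m)
      = (\<Sum>x\<in>Poly_Mapping.keys f. if m = x then Poly_Mapping.lookup f m else 0)"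
    by (intro sum.cong) (auto simp: lookup_single when_def)
  then show "Poly_Mapping.lookup f m =
      Poly_Mapping.lookup (\<Sum>m\<in>Poly_Mapping.keys f. Poly_Mapping.single m (Poly_Mapping.lookup f m)) m"
    by (simp add: lookup_sum in_keys_iff)
qed

section \<open>Surjectivity in terms of polynomials\<close>

lemma polys_in_0 [simp]: "0 \<in> polys_in V"
  and polys_in_1 [simp]: "1 \<in> polys_in V"
  by (simp_all add: polys_in_def)

lemma polys_in_add: "f \<in> polys_in V \<Longrightarrow> g \<in> polys_in V \<Longrightarrow> f + g \<in> polys_in V"
  using Poly_Mapping.keys_add[of f g] by (fastforce simp: polys_in_def)

lemma polys_in_mult: "f \<in> polys_in V \<Longrightarrow> g \<in> polys_in V \<Longrightarrow> f * g \<in> polys_in V"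
  using keys_mult[of f g] by (fastforce simp: polys_in_def keys_add_nat)

lemma polys_in_uminus: "f \<in> polys_in V \<Longrightarrow> - f \<in> polys_in V"
  by (simp add: polys_in_def)

lemma polys_in_diff: "f \<in> polys_in V \<Longrightarrow> g \<in> polys_in V \<Longrightarrow> f - g \<in> polys_in V"
  using polys_in_add[of f V "- g"] polys_in_uminus[of g V] by simp

lemma polys_in_sum: "(\<And>j. j \<in> J \<Longrightarrow> f j \<in> polys_in V) \<Longrightarrow> (\<Sum>j\<in>J. f j) \<in> polys_in V"
  by (induction J rule: infinite_finite_induct) (auto intro: polys_in_add)

lemma polys_in_prod: "(\<And>j. j \<in> J \<Longrightarrow> f j \<in> polys_in V) \<Longrightarrow> (\<Prod>j\<in>J. f j) \<in> polys_in V"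
  by (induction J rule: infinite_finite_induct) (auto intro: polys_in_mult)

lemma poly_ring_simps [simp]:
  "carrier (poly_ring V) = polys_in V" "f \<otimes>\<^bsub>poly_ring V\<^esub> g = f * g"
  "f \<oplus>\<^bsub>poly_ring V\<^esub> g = f + g" "\<one>\<^bsub>poly_ring V\<^esub> = 1" "\<zero>\<^bsub>poly_ring V\<^esub> = 0"
  by (simp_all add: poly_ring_def)

lemma cring_poly_ring: "cring (poly_ring V :: ('v, 'k::field) mpoly ring)"
proof (rule cringI)
  show "abelian_group (poly_ring V :: ('v, 'k) mpoly ring)"
  proof (rule abelian_groupI)
    fix x :: "('v, 'k) mpoly" assume "x \<in> carrier (poly_ring V)"
    then show "\<exists>y\<in>carrier (poly_ring V). y \<oplus>\<^bsub>poly_ring V\<^esub> x = \<zero>\<^bsub>poly_ring V\<^esub>"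
      by (intro bexI[of _ "- x"]) (simp_all add: polys_in_uminus)
  qed (simp_all add: polys_in_add add.assoc add.commute)
  show "Group.comm_monoid (poly_ring V :: ('v, 'k) mpoly ring)"
    by (rule comm_monoidI) (auto simp: polys_in_mult mult.assoc mult.commute)
qed (simp add: algebra_simps)

lemma poly_ring_minus [simp]:
  fixes f g :: "('v, 'k::field) mpoly"
  assumes "f \<in> polys_in V" "g \<in> polys_in V"
  shows "f \<ominus>\<^bsub>poly_ring V\<^esub> g = f - g"
proof -
  interpret cring "poly_ring V :: ('v, 'k) mpoly ring" by (rule cring_poly_ring)
  have "\<ominus>\<^bsub>poly_ring V\<^esub> g = - g"
    using assms by (intro minus_equality) (auto simp: polys_in_uminus)
  then show ?thesis by (simp add: a_minus_def)
qed

text \<open>Closure under negation comes from multiplying by -1.\<close>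

lemma ideal_poly_ringI:
  fixes I :: "('v, 'k::field) mpoly set"
  assumes "I \<subseteq> polys_in V" "0 \<in> I"
    and add: "\<And>a b. a \<in> I \<Longrightarrow> b \<in> I \<Longrightarrow> a + b \<in> I"
    and mult: "\<And>a x. a \<in> I \<Longrightarrow> x \<in> polys_in V \<Longrightarrow> x * a \<in> I"
  shows "ideal I (poly_ring V)"
proof -
  interpret cring "poly_ring V :: ('v, 'k) mpoly ring" by (rule cring_poly_ring)
  show ?thesis
  proof (rule idealI)
    show "subgroup I (add_monoid (poly_ring V))"
    proof (rule add.subgroupI)
      fix a assume a: "a \<in> I"
      then have "a \<in> polys_in V" using assms(1) by blast
      then have "\<ominus>\<^bsub>poly_ring V\<^esub> a = - a"
        by (intro minus_equality) (auto simp: polys_in_uminus)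
      moreover have "- a \<in> I" using mult[OF a, of "- 1"] by (simp add: polys_in_uminus)
      ultimately show "\<ominus>\<^bsub>poly_ring V\<^esub> a \<in> I" by simp
    qed (use assms in auto)
  next
    fix a x :: "('v, 'k) mpoly" assume "a \<in> I" "x \<in> carrier (poly_ring V)"
    then show "x \<otimes>\<^bsub>poly_ring V\<^esub> a \<in> I" "a \<otimes>\<^bsub>poly_ring V\<^esub> x \<in> I"
      using mult[of a x] by (simp_all add: mult.commute)
  qed (rule ring_axioms)
qed

section \<open>The face ideal as a span of monomials\<close>

text \<open>The Stanley-Reisner ideal extended to all variables of the type: a monomial with a
  variable outside the vertices has a support that is no face, so it belongs here as well.\<close>

definition nonface_polys :: "'v set set \<Rightarrow> ('v, 'k::field) mpoly set" where
  "nonface_polys \<Gamma> = {f. \<forall>m. Poly_Mapping.lookup f m \<noteq> 0 \<longrightarrow> Poly_Mapping.keys m \<notin> \<Gamma>}"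

lemma nonface_polys_0 [simp]: "0 \<in> nonface_polys \<Gamma>"
  by (simp add: nonface_polys_def)

lemma nonface_polys_add:
  "f \<in> nonface_polys \<Gamma> \<Longrightarrow> g \<in> nonface_polys \<Gamma> \<Longrightarrow> f + g \<in> nonface_polys \<Gamma>"
  unfolding nonface_polys_def in_keys_iff[symmetric] using Poly_Mapping.keys_add[of f g] by blast

lemma nonface_polys_mult:
  assumes "simplicial_complex \<Gamma>" "f \<in> nonface_polys \<Gamma>"
  shows "x * f \<in> nonface_polys \<Gamma>"
  unfolding nonface_polys_def
proof (clarify)
  fix m assume m: "Poly_Mapping.lookup (x * f) m \<noteq> 0" "Poly_Mapping.keys m \<in> \<Gamma>"
  then obtain a b where ab: "m = a + b" "Poly_Mapping.lookup f b \<noteq> 0"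
    using keys_mult[of x f] by (auto simp: in_keys_iff)
  have "Poly_Mapping.keys b \<subseteq> Poly_Mapping.keys m"
    using ab(1) by (auto simp: keys_add_nat)
  then have "Poly_Mapping.keys b \<in> \<Gamma>"
    using assms(1) m(2) by (auto simp: simplicial_complex_def)
  then show False using assms(2) ab(2) by (auto simp: nonface_polys_def)
qed

lemma prod_indet:
  assumes "finite \<sigma>"
  obtains e where "(\<Prod>v\<in>\<sigma>. indet v :: ('v, 'k::field) mpoly) = Poly_Mapping.single e 1"
    "\<And>u. Poly_Mapping.lookup e u = (if u \<in> \<sigma> then 1 else 0)"
proof
  let ?e = "\<Sum>v\<in>\<sigma>. Poly_Mapping.single v (1::nat)"
  show "(\<Prod>v\<in>\<sigma>. indet v :: ('v, 'k) mpoly) = Poly_Mapping.single ?e 1"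
    using assms by induction (auto simp: indet_def mult_single)
  show "Poly_Mapping.lookup ?e u = (if u \<in> \<sigma> then 1 else 0)" for u
    using assms by (simp add: lookup_sum lookup_single when_def)
qed

lemma indet_polys_in: "v \<in> V \<Longrightarrow> indet v \<in> polys_in V"
  by (simp add: indet_def polys_in_def)

lemma face_ideal_generators:
  "{\<Prod>v\<in>\<sigma>. indet v | \<sigma>. \<sigma> \<subseteq> vertices \<Gamma> \<and> \<sigma> \<notin> \<Gamma>} \<subseteq> polys_in (vertices \<Gamma>)"
  by (auto intro!: polys_in_prod indet_polys_in)

lemma ideal_face_ideal:
  "ideal (face_ideal \<Gamma> :: ('v, 'k::field) mpoly set) (poly_ring (vertices \<Gamma>))"
proof -
  interpret cring "poly_ring (vertices \<Gamma>) :: ('v, 'k) mpoly ring" by (rule cring_poly_ring)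
  show ?thesis unfolding face_ideal_def
    by (rule genideal_ideal) (use face_ideal_generators in simp)
qed

lemma finite_vertices: "simplicial_complex \<Gamma> \<Longrightarrow> finite (vertices \<Gamma>)"
  by (auto simp: simplicial_complex_def vertices_def)

text \<open>The right-hand side is an ideal containing the generators, because faces are closed
  under subsets. Conversely, a monomial whose support is not a face is a multiple of the squarefree
  monomial on its support, which is a generator.\<close>

lemma face_ideal_eq:
  assumes "simplicial_complex \<Gamma>"
  shows "face_ideal \<Gamma> = polys_in (vertices \<Gamma>) \<inter> (nonface_polys \<Gamma> :: ('v, 'k::field) mpoly set)"
proof
  let ?V = "vertices \<Gamma>"
  let ?G = "{\<Prod>v\<in>\<sigma>. indet v | \<sigma>. \<sigma> \<subseteq> vertices \<Gamma> \<and> \<sigma> \<notin> \<Gamma>} :: ('v, 'k) mpoly set"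
  interpret cring "poly_ring ?V :: ('v, 'k) mpoly ring" by (rule cring_poly_ring)
  have fin: "finite \<sigma>" if "\<sigma> \<subseteq> ?V" for \<sigma>
    using that finite_vertices[OF assms] finite_subset by blast
  have id: "ideal (polys_in ?V \<inter> nonface_polys \<Gamma>) (poly_ring ?V :: ('v, 'k) mpoly ring)"
    using nonface_polys_mult[OF assms]
    by (intro ideal_poly_ringI) (auto intro: polys_in_add polys_in_mult nonface_polys_add)
  show "face_ideal \<Gamma> \<subseteq> polys_in ?V \<inter> (nonface_polys \<Gamma> :: ('v, 'k) mpoly set)"
    unfolding face_ideal_def
  proof (rule genideal_minimal[OF id])
    have "(\<Prod>v\<in>\<sigma>. indet v) \<in> (nonface_polys \<Gamma> :: ('v, 'k) mpoly set)"
      if \<sigma>: "\<sigma> \<subseteq> ?V" "\<sigma> \<notin> \<Gamma>" for \<sigma>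
    proof -
      obtain e where e: "(\<Prod>v\<in>\<sigma>. indet v :: ('v, 'k) mpoly) = Poly_Mapping.single e 1"
        "\<And>u. Poly_Mapping.lookup e u = (if u \<in> \<sigma> then 1 else 0)"
        using prod_indet[OF fin[OF \<sigma>(1)]] by blast
      have "Poly_Mapping.keys e = \<sigma>" using e(2) by (auto simp: in_keys_iff split: if_splits)
      then show ?thesis using \<sigma>(2) unfolding e(1)
        by (auto simp: nonface_polys_def lookup_single when_def)
    qed
    then show "?G \<subseteq> polys_in ?V \<inter> nonface_polys \<Gamma>"
      using face_ideal_generators by blast
  qed
  show "polys_in ?V \<inter> nonface_polys \<Gamma> \<subseteq> (face_ideal \<Gamma> :: ('v, 'k) mpoly set)"
  proof
    interpret I: ideal "face_ideal \<Gamma>" "poly_ring ?V :: ('v, 'k) mpoly ring"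
      by (rule ideal_face_ideal)
    fix f :: "('v, 'k) mpoly" assume f: "f \<in> polys_in ?V \<inter> nonface_polys \<Gamma>"
    have mon: "Poly_Mapping.single m c \<in> face_ideal \<Gamma>"
      if m: "Poly_Mapping.keys m \<subseteq> ?V" "Poly_Mapping.keys m \<notin> \<Gamma>" for m and c :: 'k
    proof -
      obtain e where e: "(\<Prod>v\<in>Poly_Mapping.keys m. indet v :: ('v, 'k) mpoly) = Poly_Mapping.single e 1"
        "\<And>u. Poly_Mapping.lookup e u = (if u \<in> Poly_Mapping.keys m then 1 else 0)"
        using prod_indet[OF finite_keys[of m]] by blast
      \<comment> \<open>Truncated subtraction is exact here: \<open>e\<close> is the indicator of
        the support of \<open>m\<close>, so \<open>e\<close> is at most \<open>m\<close> in every
        exponent.\<close>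
      have "m = e + (m - e)"
        by (rule poly_mapping_eqI) (auto simp: lookup_add lookup_minus e(2) in_keys_iff)
      then have s: "Poly_Mapping.single m c =
          Poly_Mapping.single (m - e) c * (\<Prod>v\<in>Poly_Mapping.keys m. indet v)"
        unfolding e(1) by (simp add: mult_single add.commute)
      have "(\<Prod>v\<in>Poly_Mapping.keys m. indet v) \<in> (face_ideal \<Gamma> :: ('v, 'k) mpoly set)"
        unfolding face_ideal_def
        by (rule subsetD[OF genideal_self]) (use face_ideal_generators[of \<Gamma>] m in auto)
      moreover have "Poly_Mapping.keys (m - e) \<subseteq> Poly_Mapping.keys m"
        by (auto simp: in_keys_iff lookup_minus)
      then have "Poly_Mapping.single (m - e) c \<in> polys_in ?V"
        using m(1) by (auto simp: polys_in_def)
      ultimately show ?thesis unfolding s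
        using I.I_l_closed[of "\<Prod>v\<in>Poly_Mapping.keys m. indet v" "Poly_Mapping.single (m - e) c"] by simp
    qed
    have sum: "(\<Sum>x\<in>A. g x) \<in> face_ideal \<Gamma>" if "\<And>x. x \<in> A \<Longrightarrow> g x \<in> face_ideal \<Gamma>"
      for g :: "('v \<Rightarrow>\<^sub>0 nat) \<Rightarrow> ('v, 'k) mpoly" and A
      using that
      by (induction A rule: infinite_finite_induct) (use I.zero_closed I.a_closed in auto)
    have "(\<Sum>m\<in>Poly_Mapping.keys f. Poly_Mapping.single m (Poly_Mapping.lookup f m)) \<in> face_ideal \<Gamma>"
      by (rule sum, rule mon) (use f in \<open>auto simp: polys_in_def nonface_polys_def in_keys_iff\<close>)
    then show "f \<in> face_ideal \<Gamma>" using sum_monomials[of f] by simp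
  qed
qed

section \<open>The quotient by the parameters, pulled back to polynomials\<close>

text \<open>The preimage of \<open>param_ideal\<close> in the polynomial ring (see
  \<open>face_class_in_param_ideal\<close>). It replaces computations with cosets of cosets by
  explicit sums of polynomials.\<close>

definition lifted_param_ideal ::
  "'v set set \<Rightarrow> ('v, 'k::field) mpoly list \<Rightarrow> ('v, 'k) mpoly set" where
  "lifted_param_ideal \<Gamma> \<Theta> = {(\<Sum>j<length \<Theta>. \<Theta> ! j * h j) + p | h p.
     (\<forall>j. h j \<in> polys_in (vertices \<Gamma>)) \<and> p \<in> face_ideal \<Gamma>}"

context
  fixes \<Gamma> :: "'v set set" and \<Theta> :: "('v, 'k::field) mpoly list"
  assumes \<Theta>: "set \<Theta> \<subseteq> polys_in (vertices \<Gamma>)"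
begin

interpretation R: cring "poly_ring (vertices \<Gamma>) :: ('v, 'k) mpoly ring"
  by (rule cring_poly_ring)

interpretation I: ideal "face_ideal \<Gamma>" "poly_ring (vertices \<Gamma>) :: ('v, 'k) mpoly ring"
  by (rule ideal_face_ideal)

interpretation F: cring "face_ring \<Gamma> :: ('v, 'k) mpoly set ring"
  unfolding face_ring_def by (rule I.quotient_is_cring[OF cring_poly_ring])

interpretation f: ring_hom_ring "poly_ring (vertices \<Gamma>) :: ('v, 'k) mpoly ring" "face_ring \<Gamma>" "face_class \<Gamma>"
  unfolding face_ring_def using I.rcos_ring_hom_ring by (simp add: face_class_def[abs_def])

lemma nth_polys_in: "j < length \<Theta> \<Longrightarrow> \<Theta> ! j \<in> polys_in (vertices \<Gamma>)"
  using \<Theta> nth_mem by blast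

lemma ideal_param_ideal: "ideal (param_ideal \<Gamma> \<Theta>) (face_ring \<Gamma>)"
  unfolding param_ideal_def using \<Theta> f.hom_closed by (intro F.genideal_ideal) auto

interpretation P: ideal "param_ideal \<Gamma> \<Theta>" "face_ring \<Gamma>"
  by (rule ideal_param_ideal)

interpretation q: ring_hom_ring "face_ring \<Gamma>" "quotient_ring \<Gamma> \<Theta>"
  "(+>\<^bsub>face_ring \<Gamma>\<^esub>) (param_ideal \<Gamma> \<Theta>)"
  unfolding quotient_ring_def by (rule P.rcos_ring_hom_ring)

lemma lifted_param_ideal_subset: "lifted_param_ideal \<Gamma> \<Theta> \<subseteq> polys_in (vertices \<Gamma>)"
  unfolding lifted_param_ideal_def using I.Icarr
  by (auto intro!: polys_in_add polys_in_sum polys_in_mult nth_polys_in)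

lemma ideal_lifted_param_ideal: "ideal (lifted_param_ideal \<Gamma> \<Theta>) (poly_ring (vertices \<Gamma>))"
proof (rule ideal_poly_ringI[OF lifted_param_ideal_subset])
  show "0 \<in> lifted_param_ideal \<Gamma> \<Theta>"
    unfolding lifted_param_ideal_def using I.zero_closed
    by (auto intro!: exI[of _ "\<lambda>_. 0"])
next
  fix a b assume "a \<in> lifted_param_ideal \<Gamma> \<Theta>" "b \<in> lifted_param_ideal \<Gamma> \<Theta>"
  then obtain h p h' p' where
    "a = (\<Sum>j<length \<Theta>. \<Theta> ! j * h j) + p" "\<forall>j. h j \<in> polys_in (vertices \<Gamma>)" "p \<in> face_ideal \<Gamma>"
    "b = (\<Sum>j<length \<Theta>. \<Theta> ! j * h' j) + p'" "\<forall>j. h' j \<in> polys_in (vertices \<Gamma>)" "p' \<in> face_ideal \<Gamma>"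
    unfolding lifted_param_ideal_def by blast
  then show "a + b \<in> lifted_param_ideal \<Gamma> \<Theta>"
    unfolding lifted_param_ideal_def using I.a_closed[of p p']
    by (intro CollectI exI[of _ "\<lambda>j. h j + h' j"] exI[of _ "p + p'"])
      (auto simp: algebra_simps sum.distrib intro: polys_in_add)
next
  fix a x :: "('v, 'k) mpoly"
  assume "a \<in> lifted_param_ideal \<Gamma> \<Theta>" "x \<in> polys_in (vertices \<Gamma>)"
  moreover from this obtain h p where
    "a = (\<Sum>j<length \<Theta>. \<Theta> ! j * h j) + p" "\<forall>j. h j \<in> polys_in (vertices \<Gamma>)" "p \<in> face_ideal \<Gamma>"
    unfolding lifted_param_ideal_def by blast
  ultimately show "x * a \<in> lifted_param_ideal \<Gamma> \<Theta>"
    unfolding lifted_param_ideal_def using I.I_l_closed[of p x]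
    by (intro CollectI exI[of _ "\<lambda>j. x * h j"] exI[of _ "x * p"])
      (auto simp: algebra_simps sum_distrib_left intro: polys_in_mult)
qed

interpretation K: ideal "lifted_param_ideal \<Gamma> \<Theta>" "poly_ring (vertices \<Gamma>)"
  by (rule ideal_lifted_param_ideal)

lemma nth_lifted_param_ideal: "i < length \<Theta> \<Longrightarrow> \<Theta> ! i \<in> lifted_param_ideal \<Gamma> \<Theta>"
  unfolding lifted_param_ideal_def using I.zero_closed
  by (intro CollectI exI[of _ "\<lambda>j. if j = i then 1 else 0"] exI[of _ 0])
    (auto simp: if_distrib sum.delta cong: if_cong)

lemma face_ideal_subset_lifted: "(face_ideal \<Gamma> :: ('v, 'k) mpoly set) \<subseteq> lifted_param_ideal \<Gamma> \<Theta>"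
  unfolding lifted_param_ideal_def
  by (auto intro!: exI[of _ "\<lambda>_. 0"])

lemma face_class_eq_iff:
  fixes g g' :: "('v, 'k) mpoly"
  assumes "g \<in> polys_in (vertices \<Gamma>)" "g' \<in> polys_in (vertices \<Gamma>)"
  shows "face_class \<Gamma> g = face_class \<Gamma> g' \<longleftrightarrow> g - g' \<in> face_ideal \<Gamma>"
  using R.quotient_eq_iff_same_a_r_cos[OF ideal_face_ideal, of g g'] assms by (simp add: face_class_def)

text \<open>The image of the lifted ideal in the face ring is an ideal containing the classes of
  \<Theta>, so it contains \<open>param_ideal\<close> by minimality; changing the representative
  costs only an element of the face ideal, which is part of the lifted ideal. In the other direction
  \<open>face_class\<close> is a homomorphism that kills the summand \<open>p\<close>.\<close>

lemma face_class_in_param_ideal: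
  assumes g: "g \<in> polys_in (vertices \<Gamma>)"
  shows "face_class \<Gamma> g \<in> param_ideal \<Gamma> \<Theta> \<longleftrightarrow> g \<in> lifted_param_ideal \<Gamma> \<Theta>"
proof
  have "ideal (face_class \<Gamma> ` lifted_param_ideal \<Gamma> \<Theta>) (face_ring \<Gamma>)"
    unfolding face_ring_def
    using R.ring_ideal_imp_quot_ideal[OF ideal_face_ideal ideal_lifted_param_ideal]
    by (simp add: face_class_def[abs_def])
  moreover have "face_class \<Gamma> ` set \<Theta> \<subseteq> face_class \<Gamma> ` lifted_param_ideal \<Gamma> \<Theta>"
    using nth_lifted_param_ideal by (auto simp: in_set_conv_nth)
  ultimately have "param_ideal \<Gamma> \<Theta> \<subseteq> face_class \<Gamma> ` lifted_param_ideal \<Gamma> \<Theta>"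
    unfolding param_ideal_def by (rule F.genideal_minimal)
  moreover assume "face_class \<Gamma> g \<in> param_ideal \<Gamma> \<Theta>"
  ultimately obtain k where k: "k \<in> lifted_param_ideal \<Gamma> \<Theta>" "face_class \<Gamma> g = face_class \<Gamma> k"
    by blast
  then have "g - k \<in> lifted_param_ideal \<Gamma> \<Theta>"
    using face_class_eq_iff[OF g, of k] face_ideal_subset_lifted lifted_param_ideal_subset by blast
  then show "g \<in> lifted_param_ideal \<Gamma> \<Theta>"
    using K.a_closed[of "g - k" k] k(1) by simp
next
  have \<theta>: "face_class \<Gamma> (\<Theta> ! j) \<in> param_ideal \<Gamma> \<Theta>" if "j < length \<Theta>" for j
    unfolding param_ideal_def
    using that \<Theta> f.hom_closed by (intro subsetD[OF F.genideal_self]) auto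
  assume "g \<in> lifted_param_ideal \<Gamma> \<Theta>"
  then obtain h p where g: "g = (\<Sum>j<length \<Theta>. \<Theta> ! j * h j) + p"
    and h: "\<forall>j. h j \<in> polys_in (vertices \<Gamma>)" and p: "p \<in> face_ideal \<Gamma>"
    unfolding lifted_param_ideal_def by blast
  \<comment> \<open>Induction over partial sums. Membership in \<open>polys_in\<close> is carried
    along because the homomorphism laws hold only on the carrier.\<close>
  have "n \<le> length \<Theta> \<Longrightarrow> (\<Sum>j<n. \<Theta> ! j * h j) \<in> polys_in (vertices \<Gamma>) \<and>
      face_class \<Gamma> (\<Sum>j<n. \<Theta> ! j * h j) \<in> param_ideal \<Gamma> \<Theta>" for n
  proof (induction n)
    case 0
    then show ?case using f.hom_zero P.zero_closed by simp
  next
    case (Suc n)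
    have m: "\<Theta> ! n * h n \<in> polys_in (vertices \<Gamma>)"
      using Suc h by (simp add: Suc_le_eq polys_in_mult nth_polys_in)
    have "face_class \<Gamma> (\<Theta> ! n * h n) = face_class \<Gamma> (\<Theta> ! n) \<otimes>\<^bsub>face_ring \<Gamma>\<^esub> face_class \<Gamma> (h n)"
      using f.hom_mult[of "\<Theta> ! n" "h n"] Suc h nth_polys_in by simp
    then have "face_class \<Gamma> (\<Theta> ! n * h n) \<in> param_ideal \<Gamma> \<Theta>"
      using P.I_r_closed[OF \<theta>[of n] f.hom_closed[of "h n"]] Suc h by simp
    then show ?case
      using Suc m f.hom_add[of "\<Sum>j<n. \<Theta> ! j * h j" "\<Theta> ! n * h n"] P.a_closed
      by (auto intro: polys_in_add)
  qed
  then have s: "(\<Sum>j<length \<Theta>. \<Theta> ! j * h j) \<in> polys_in (vertices \<Gamma>)"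
      "face_class \<Gamma> (\<Sum>j<length \<Theta>. \<Theta> ! j * h j) \<in> param_ideal \<Gamma> \<Theta>" by auto
  have "face_class \<Gamma> g = face_class \<Gamma> (\<Sum>j<length \<Theta>. \<Theta> ! j * h j)"
    using face_class_eq_iff[OF assms s(1)] p g by simp
  then show "face_class \<Gamma> g \<in> param_ideal \<Gamma> \<Theta>" using s(2) by simp
qed

lemma quotient_class_eq_iff:
  assumes "g \<in> polys_in (vertices \<Gamma>)" "g' \<in> polys_in (vertices \<Gamma>)"
  shows "quotient_class \<Gamma> \<Theta> g = quotient_class \<Gamma> \<Theta> g' \<longleftrightarrow> g - g' \<in> lifted_param_ideal \<Gamma> \<Theta>"
proof -
  have "face_class \<Gamma> g \<ominus>\<^bsub>face_ring \<Gamma>\<^esub> face_class \<Gamma> g' = face_class \<Gamma> (g - g')"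
  proof -
    have c: "face_class \<Gamma> (g - g') \<in> carrier (face_ring \<Gamma>)" "face_class \<Gamma> g' \<in> carrier (face_ring \<Gamma>)"
      using assms by (auto intro!: f.hom_closed polys_in_diff)
    have "face_class \<Gamma> g = face_class \<Gamma> (g - g') \<oplus>\<^bsub>face_ring \<Gamma>\<^esub> face_class \<Gamma> g'"
      using f.hom_add[of "g - g'" g'] assms by (simp add: polys_in_diff)
    then show ?thesis using c by (simp add: a_minus_def F.a_assoc F.r_neg)
  qed
  then show ?thesis
    unfolding quotient_class_def
    using F.quotient_eq_iff_same_a_r_cos[OF ideal_param_ideal, of "face_class \<Gamma> g" "face_class \<Gamma> g'"]
      assms f.hom_closed face_class_in_param_ideal[of "g - g'"] polys_in_diff[OF assms]
    by simp
qed

lemma quotient_class_mult: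
  assumes "g \<in> polys_in (vertices \<Gamma>)" "g' \<in> polys_in (vertices \<Gamma>)"
  shows "quotient_class \<Gamma> \<Theta> g \<otimes>\<^bsub>quotient_ring \<Gamma> \<Theta>\<^esub> quotient_class \<Gamma> \<Theta> g' = quotient_class \<Gamma> \<Theta> (g * g')"
  unfolding quotient_class_def
  using q.hom_mult[of "face_class \<Gamma> g" "face_class \<Gamma> g'"] f.hom_mult[of g g'] assms f.hom_closed by simp

text \<open>Products with \<omega> stay in degree \<open>i + 1\<close>, so one inclusion of the
  image equality is automatic and the other says that every class of degree \<open>i + 1\<close> is
  hit.\<close>

lemma surjective_iff:
  assumes \<omega>: "\<omega> \<in> homogeneous (vertices \<Gamma>) 1"
  shows "(\<lambda>a. quotient_class \<Gamma> \<Theta> \<omega> \<otimes>\<^bsub>quotient_ring \<Gamma> \<Theta>\<^esub> a) ` quotient_part \<Gamma> \<Theta> i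
       = quotient_part \<Gamma> \<Theta> (i + 1) \<longleftrightarrow>
    (\<forall>f\<in>homogeneous (vertices \<Gamma>) (i + 1). \<exists>g\<in>homogeneous (vertices \<Gamma>) i.
      f - \<omega> * g \<in> lifted_param_ideal \<Gamma> \<Theta>)"
proof -
  note sub = subsetD[OF homogeneous_subset_polys_in]
  have m: "\<omega> * g \<in> homogeneous (vertices \<Gamma>) (i + 1)" if "g \<in> homogeneous (vertices \<Gamma>) i" for g
    using homogeneous_mult[OF \<omega> that] by simp
  have *: "(\<lambda>a. quotient_class \<Gamma> \<Theta> \<omega> \<otimes>\<^bsub>quotient_ring \<Gamma> \<Theta>\<^esub> a) ` quotient_part \<Gamma> \<Theta> i
      = (\<lambda>g. quotient_class \<Gamma> \<Theta> (\<omega> * g)) ` homogeneous (vertices \<Gamma>) i"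
    unfolding quotient_part_def image_image
    using quotient_class_mult[OF sub[OF \<omega>] sub] by (intro image_cong) auto
  have "(\<lambda>g. quotient_class \<Gamma> \<Theta> (\<omega> * g)) ` homogeneous (vertices \<Gamma>) i
      = quotient_part \<Gamma> \<Theta> (i + 1) \<longleftrightarrow>
    (\<forall>f\<in>homogeneous (vertices \<Gamma>) (i + 1). \<exists>g\<in>homogeneous (vertices \<Gamma>) i.
      quotient_class \<Gamma> \<Theta> f = quotient_class \<Gamma> \<Theta> (\<omega> * g))"
    unfolding quotient_part_def using m by (auto simp: image_iff set_eq_iff)
  also have "\<dots> \<longleftrightarrow> (\<forall>f\<in>homogeneous (vertices \<Gamma>) (i + 1). \<exists>g\<in>homogeneous (vertices \<Gamma>) i.
      f - \<omega> * g \<in> lifted_param_ideal \<Gamma> \<Theta>)"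
    using quotient_class_eq_iff[OF sub sub[OF m]] by simp
  finally show ?thesis unfolding * .
qed

end

lemma L_s_iff:
  "(\<omega>, \<Theta>) \<in> L_s i \<Gamma> \<longleftrightarrow> \<omega> \<in> homogeneous (vertices \<Gamma>) 1 \<and> lsop \<Gamma> \<Theta> \<and>
    (\<forall>f\<in>homogeneous (vertices \<Gamma>) (i + 1). \<exists>g\<in>homogeneous (vertices \<Gamma>) i.
      f - \<omega> * g \<in> lifted_param_ideal \<Gamma> \<Theta>)"
proof -
  have "set \<Theta> \<subseteq> polys_in (vertices \<Gamma>)" if "lsop \<Gamma> \<Theta>"
    using that homogeneous_subset_polys_in unfolding lsop_def by blast
  then show ?thesis
    using surjective_iff[of \<Theta> \<Gamma> \<omega> i]
    by (cases "\<omega> \<in> homogeneous (vertices \<Gamma>) 1 \<and> lsop \<Gamma> \<Theta>") (auto simp only: L_s_def mem_Collect_eq prod.case)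
qed

section \<open>Generic linear forms\<close>

text \<open>The ideal generated by the \<open>L j\<close> maps onto the space of coefficient vectors indexed
  by \<open>S\<close>.  All genericity conditions of the proof have this form.\<close>

definition spans ::
  "nat set \<Rightarrow> (nat \<Rightarrow> ('v, 'k::field) mpoly) \<Rightarrow> ('v \<Rightarrow>\<^sub>0 nat) set \<Rightarrow> bool" where
  "spans J L S \<longleftrightarrow> (\<forall>s\<in>S. \<exists>h. \<forall>s'\<in>S.
     Poly_Mapping.lookup (\<Sum>j\<in>J. L j * h j) s' = (if s = s' then 1 else 0))"

lemma spansI:
  assumes "\<And>s s'. s \<in> S \<Longrightarrow> s' \<in> S \<Longrightarrow>
    Poly_Mapping.lookup (\<Sum>j\<in>J. L j * h s j) s' = (if s = s' then 1 else 0)"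
  shows "spans J L S"
  unfolding spans_def
proof
  fix s assume "s \<in> S"
  then show "\<exists>h. \<forall>s'\<in>S. Poly_Mapping.lookup (\<Sum>j\<in>J. L j * h j) s' = (if s = s' then 1 else 0)"
    using assms by (intro exI[of _ "h s"]) simp
qed

lemma lookup_const_mult:
  "Poly_Mapping.lookup (Poly_Mapping.single 0 c * f) m = c * Poly_Mapping.lookup f m"
  for f :: "('v, 'k::field) mpoly"
  by (simp add: mult_map_scale_conv_mult[symmetric] Poly_Mapping.map.rep_eq when_def)

lemma const_mult_homogeneous: "f \<in> homogeneous V i \<Longrightarrow> Poly_Mapping.single 0 c * f \<in> homogeneous V i"
  by (auto simp: homogeneous_iff lookup_const_mult)

lemma homogeneous_diff:
  assumes "f \<in> homogeneous V i" "g \<in> homogeneous V i"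
  shows "f - g \<in> homogeneous V i"
proof -
  have "- g \<in> homogeneous V i" using assms(2) by (simp add: homogeneous_iff)
  from homogeneous_add[OF assms(1) this] show ?thesis by simp
qed

section \<open>Genericity along lines\<close>

text \<open>Keep the cofactors that work at t = 0 and move the forms. The coefficient matrix on
  \<open>S\<close> becomes I + t B, and any left inverse of it repairs the cofactors.\<close>

lemma spans_line:
  fixes L L' :: "nat \<Rightarrow> ('v, 'k::field) mpoly"
  assumes "finite S" "spans J L S"
  shows "finite {t. \<not> spans J (\<lambda>j. L j + Poly_Mapping.single 0 t * L' j) S}"
proof -
  obtain h where h: "\<And>s s'. s \<in> S \<Longrightarrow> s' \<in> S \<Longrightarrow>
      Poly_Mapping.lookup (\<Sum>j\<in>J. L j * h s j) s' = (if s = s' then 1 else 0)"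
    using assms(2) unfolding spans_def by metis
  \<comment> \<open>The contribution of the direction \<open>L'\<close> to the coefficients on
    \<open>S\<close>, with the old cofactors.\<close>
  define B where "B s s' = Poly_Mapping.lookup (\<Sum>j\<in>J. L' j * h s j) s'" for s s'
  show ?thesis
  proof (rule finite_subset[OF _ finite_singular_parameters[OF assms(1), of B]], rule subsetI, rule CollectI, rule notI)
    fix t
    assume "t \<in> {t. \<not> spans J (\<lambda>j. L j + Poly_Mapping.single 0 t * L' j) S}"
    moreover assume "\<exists>D. \<forall>r\<in>S. \<forall>s'\<in>S.
      (\<Sum>s\<in>S. D r s * ((if s = s' then 1 else 0) + t * B s s')) = (if r = s' then 1 else 0)"
    then obtain D where D: "\<And>r s'. r \<in> S \<Longrightarrow> s' \<in> S \<Longrightarrow>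
      (\<Sum>s\<in>S. D r s * ((if s = s' then 1 else 0) + t * B s s')) = (if r = s' then 1 else 0)"
      by blast
    \<comment> \<open>The new cofactors are the combinations of the old ones with constant
      coefficients \<open>D r s\<close>; their coefficient matrix is \<open>D\<close> times I + t
      B.\<close>
    have "Poly_Mapping.lookup (\<Sum>j\<in>J. (L j + Poly_Mapping.single 0 t * L' j) *
        (\<Sum>s\<in>S. Poly_Mapping.single 0 (D r s) * h s j)) s' = (if r = s' then 1 else 0)"
      if r: "r \<in> S" and s': "s' \<in> S" for r s'
    proof -
      have "(\<Sum>j\<in>J. (L j + Poly_Mapping.single 0 t * L' j) *
          (\<Sum>s\<in>S. Poly_Mapping.single 0 (D r s) * h s j))
        = (\<Sum>j\<in>J. \<Sum>s\<in>S. Poly_Mapping.single 0 (D r s) *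
            (L j * h s j + Poly_Mapping.single 0 t * (L' j * h s j)))"
        by (simp add: sum_distrib_left algebra_simps)
      also have "\<dots> = (\<Sum>s\<in>S. Poly_Mapping.single 0 (D r s) *
            ((\<Sum>j\<in>J. L j * h s j) + Poly_Mapping.single 0 t * (\<Sum>j\<in>J. L' j * h s j)))"
        by (subst sum.swap) (simp only: sum_distrib_left sum.distrib[symmetric])
      finally have "Poly_Mapping.lookup (\<Sum>j\<in>J. (L j + Poly_Mapping.single 0 t * L' j) *
          (\<Sum>s\<in>S. Poly_Mapping.single 0 (D r s) * h s j)) s'
        = (\<Sum>s\<in>S. D r s * (Poly_Mapping.lookup (\<Sum>j\<in>J. L j * h s j) s' + t * B s s'))"
        by (simp only: lookup_sum[of _ S] lookup_const_mult lookup_add B_def)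
      also have "\<dots> = (\<Sum>s\<in>S. D r s * ((if s = s' then 1 else 0) + t * B s s'))"
        using h s' by simp
      finally show ?thesis using D[OF r s'] by simp
    qed
    then have "spans J (\<lambda>j. L j + Poly_Mapping.single 0 t * L' j) S"
      by (rule spansI)
    ultimately show False by simp
  qed
qed

text \<open>Join forms \<open>M\<close> that satisfy the earlier conditions to the forms
  \<open>L a\<close> for the new one by a line. Each condition holds at one end, hence fails at
  finitely many points only, and an infinite field has a point that avoids all of these.\<close>

lemma spans_simultaneously:
  fixes L :: "'a \<Rightarrow> nat \<Rightarrow> ('v, 'k::field) mpoly"
  assumes "infinite (UNIV :: 'k set)" "finite A"
    and "\<And>a. a \<in> A \<Longrightarrow> finite (S a)"
    and "\<And>a j. a \<in> A \<Longrightarrow> L a j \<in> homogeneous V 1"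
    and "\<And>a. a \<in> A \<Longrightarrow> spans (J a) (L a) (S a)"
  shows "\<exists>M :: nat \<Rightarrow> ('v, 'k) mpoly. (\<forall>j. M j \<in> homogeneous V 1) \<and> (\<forall>a\<in>A. spans (J a) M (S a))"
  using assms(2-)
proof (induction A)
  case empty
  then show ?case by (intro exI[of _ "\<lambda>_. 0"]) simp
next
  case (insert a A)
  have "\<exists>M :: nat \<Rightarrow> ('v, 'k) mpoly. (\<forall>j. M j \<in> homogeneous V 1) \<and> (\<forall>a\<in>A. spans (J a) M (S a))"
    by (rule insert.IH) (use insert.prems in auto)
  then obtain M :: "nat \<Rightarrow> ('v, 'k) mpoly" where "\<forall>j. M j \<in> homogeneous V 1" "\<forall>b\<in>A. spans (J b) M (S b)"
    by blast
  then have M: "M j \<in> homogeneous V 1" "b \<in> A \<Longrightarrow> spans (J b) M (S b)" for j b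
    by auto
  define N where "N t = (\<lambda>j. M j + Poly_Mapping.single 0 t * (L a j - M j))" for t
  define bad where "bad b = {t. \<not> spans (J b) (N t) (S b)}" for b
  have "finite (bad b)" if "b \<in> A" for b
    unfolding bad_def N_def using that M(2) insert.prems(1) by (intro spans_line) auto
  moreover have "finite (bad a)"
  proof -
    let ?bad = "{t. \<not> spans (J a) (\<lambda>j. L a j + Poly_Mapping.single 0 t * (M j - L a j)) (S a)}"
    have "finite ?bad"
      using insert.prems by (intro spans_line) auto
    \<comment> \<open>\<open>spans_line\<close> starts from forms that satisfy the condition at
      parameter 0, so for \<open>a\<close> the line is traversed backwards, from \<open>L a\<close>
      with parameter 1 - t.\<close>
    moreover have "N t = (\<lambda>j. L a j + Poly_Mapping.single 0 (1 - t) * (M j - L a j))" for t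
    proof -
      have "Poly_Mapping.single 0 (1 - t) = (1 - Poly_Mapping.single 0 t :: ('v, 'k) mpoly)"
        by (simp add: single_diff)
      then show ?thesis unfolding N_def by (simp only:) (simp add: algebra_simps)
    qed
    then have "bad a \<subseteq> (\<lambda>t. 1 - t) ` ?bad"
      unfolding bad_def by (auto intro!: image_eqI[of _ _ "1 - _"])
    ultimately show ?thesis using finite_surj by blast
  qed
  ultimately have "finite (\<Union>b\<in>insert a A. bad b)" using insert.hyps by simp
  then obtain t where "t \<notin> (\<Union>b\<in>insert a A. bad b)"
    using ex_new_if_finite[OF assms(1)] by blast
  then have "spans (J b) (N t) (S b)" if "b \<in> insert a A" for b
    using that unfolding bad_def by blast
  moreover have "N t j \<in> homogeneous V 1" for j
    unfolding N_def using M(1) insert.prems(2)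
    by (intro homogeneous_add const_mult_homogeneous homogeneous_diff) auto
  ultimately show ?case by blast
qed

text \<open>Place the variables of \<sigma> at distinct indices of \<open>J\<close> and zero at all
  other indices; a cofactor that is 1 at one index then picks out one variable. This provides the
  initial forms for the facets and for the exceptional vertices.\<close>

lemma spans_variables:
  assumes "finite \<sigma>" "finite J" "card \<sigma> \<le> card J" "\<sigma> \<subseteq> V"
  shows "\<exists>L :: nat \<Rightarrow> ('v, 'k::field) mpoly. (\<forall>j. L j \<in> homogeneous V 1) \<and>
    spans J L ((\<lambda>u. Poly_Mapping.single u 1) ` \<sigma>)"
proof -
  obtain e where e: "e ` \<sigma> \<subseteq> J" "inj_on e \<sigma>"
    using card_le_inj[OF assms(1-3)] by blast
  define L :: "nat \<Rightarrow> ('v, 'k) mpoly"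
    where "L j = (if j \<in> e ` \<sigma> then indet (inv_into \<sigma> e j) else 0)" for j
  have "L j \<in> homogeneous V 1" for j
    unfolding L_def using assms(4) inv_into_into[of j e \<sigma>] by (auto intro!: indet_homogeneous simp del: One_nat_def)
  moreover have e: "(\<Sum>j\<in>J. L j * (if j = e u then 1 else 0)) = indet u" if "u \<in> \<sigma>" for u
  proof -
    have "(\<Sum>j\<in>J. L j * (if j = e u then 1 else 0)) = (\<Sum>j\<in>J. if j = e u then L j else 0)"
      by (intro sum.cong) auto
    then show ?thesis using that e assms(2) by (auto simp: L_def)
  qed
  then have "spans J L ((\<lambda>u. Poly_Mapping.single u 1) ` \<sigma>)"
    unfolding spans_def
  proof (intro ballI, elim imageE)
    fix s u assume "u \<in> \<sigma>" "s = Poly_Mapping.single u (1::nat)"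
    with e
    show "\<exists>h. \<forall>s'\<in>(\<lambda>u. Poly_Mapping.single u 1) ` \<sigma>.
        Poly_Mapping.lookup (\<Sum>j\<in>J. L j * h j) s' = (if s = s' then 1 else 0)"
      by (intro exI[of _ "\<lambda>j. if j = e u then 1 else 0"]) (auto simp: indet_def lookup_single when_def)
  qed
  ultimately show ?thesis by blast
qed

lemma finite_monomials:
  assumes "finite V"
  shows "finite {m. Poly_Mapping.keys m \<subseteq> V \<and> mdeg m = k}"
proof (induction k)
  case 0
  have "{m. Poly_Mapping.keys m \<subseteq> V \<and> mdeg m = 0} \<subseteq> {0}"
    using mdeg_0 by auto
  then show ?case by (rule finite_subset) simp
next
  case (Suc k)
  have "{m. Poly_Mapping.keys m \<subseteq> V \<and> mdeg m = Suc k} \<subseteq>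
      (\<Union>u\<in>V. (+) (Poly_Mapping.single u 1) ` {m. Poly_Mapping.keys m \<subseteq> V \<and> mdeg m = k})"
  proof
    fix m assume m: "m \<in> {m. Poly_Mapping.keys m \<subseteq> V \<and> mdeg m = Suc k}"
    then obtain u m' where "m = Poly_Mapping.single u 1 + m'" "mdeg m' = k"
      using mdeg_Suc_split[of m k] by auto
    with m show "m \<in> (\<Union>u\<in>V. (+) (Poly_Mapping.single u 1) ` {m. Poly_Mapping.keys m \<subseteq> V \<and> mdeg m = k})"
      by (auto simp: keys_add_nat)
  qed
  then show ?case by (rule finite_subset) (use assms Suc in simp)
qed

section \<open>Links of vertices\<close>

lemma simplicial_complex_link:
  assumes "simplicial_complex \<Delta>" "{v} \<in> \<Delta>"
  shows "simplicial_complex (link \<Delta> {v})"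
  unfolding simplicial_complex_def
proof (intro conjI ballI allI impI)
  have "link \<Delta> {v} \<subseteq> \<Delta>"
    using assms(1) by (fastforce simp: link_def simplicial_complex_def)
  then show "finite (link \<Delta> {v})" "\<And>\<sigma>. \<sigma> \<in> link \<Delta> {v} \<Longrightarrow> finite \<sigma>"
    using assms(1) finite_subset by (auto simp: simplicial_complex_def)
  show "{} \<in> link \<Delta> {v}" using assms(2) by (simp add: link_def)
  fix \<sigma> \<tau> assume "\<sigma> \<in> link \<Delta> {v}" "\<tau> \<subseteq> \<sigma>"
  moreover from this have "\<tau> \<union> {v} \<subseteq> \<sigma> \<union> {v}" by blast
  ultimately show "\<tau> \<in> link \<Delta> {v}"
    using assms(1) unfolding link_def simplicial_complex_def by blast
qed

text \<open>Adding \<open>v\<close> to a largest face of the link gives a larger face of \<Delta>.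
  Thus an l.s.o.p. of the link has fewer than \<open>d\<close> forms, which leaves two of the
  indices 0 to \<open>d\<close> free for \<omega> and the variable of \<open>v\<close>.\<close>

lemma complex_dim_link:
  assumes "simplicial_complex \<Delta>" "{v} \<in> \<Delta>"
  shows "complex_dim (link \<Delta> {v}) < complex_dim \<Delta>"
proof -
  note link = simplicial_complex_link[OF assms]
  have "Max (card ` link \<Delta> {v}) \<in> card ` link \<Delta> {v}"
    using link by (intro Max_in) (auto simp: simplicial_complex_def)
  then obtain \<tau> where \<tau>: "\<tau> \<in> link \<Delta> {v}" "card \<tau> = Max (card ` link \<Delta> {v})" by auto
  have "finite \<tau>" using link \<tau>(1) unfolding simplicial_complex_def by blast
  moreover have "v \<notin> \<tau>" "insert v \<tau> \<in> \<Delta>"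
    using \<tau>(1) by (auto simp: link_def)
  moreover from this have "card (insert v \<tau>) \<le> Max (card ` \<Delta>)"
    using assms(1) unfolding simplicial_complex_def by (intro Max_ge) blast+
  ultimately have "Suc (card \<tau>) \<le> Max (card ` \<Delta>)" by simp
  then show ?thesis using \<tau>(2) by (simp add: complex_dim_def)
qed

text \<open>Adding the variable of \<open>v\<close> to an l.s.o.p. of the link kills \<open>v\<close> in the face ring of the
  star and leaves the face ring of the link.\<close>

lemma spans_star:
  fixes \<Delta> :: "'v::linorder set set"
  assumes \<Delta>: "simplicial_complex \<Delta>" and v: "{v} \<in> \<Delta>"
    and d: "complex_dim \<Delta> = int d - 1"
    and L_s: "(L_s i (link \<Delta> {v}) :: (('v, 'k::field) mpoly \<times> ('v, 'k) mpoly list) set) \<noteq> {}"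
  shows "\<exists>L :: nat \<Rightarrow> ('v, 'k) mpoly. (\<forall>j. L j \<in> homogeneous (vertices \<Delta>) 1) \<and>
    spans {..d} L {m. mdeg m = i + 1 \<and> insert v (Poly_Mapping.keys m) \<in> \<Delta>}"
proof -
  let ?\<Gamma> = "link \<Delta> {v}"
  let ?S = "{m. mdeg m = i + 1 \<and> insert v (Poly_Mapping.keys m) \<in> \<Delta>}"
  note \<Gamma> = simplicial_complex_link[OF \<Delta> v]
  obtain \<omega> :: "('v, 'k) mpoly" and \<Theta> where "(\<omega>, \<Theta>) \<in> L_s i ?\<Gamma>" using L_s by auto
  then have \<omega>: "\<omega> \<in> homogeneous (vertices ?\<Gamma>) 1" and \<Theta>: "lsop ?\<Gamma> \<Theta>"
    and surj: "\<And>f. f \<in> homogeneous (vertices ?\<Gamma>) (i + 1) \<Longrightarrow>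
      \<exists>g\<in>homogeneous (vertices ?\<Gamma>) i. f - \<omega> * g \<in> lifted_param_ideal ?\<Gamma> \<Theta>"
    unfolding L_s_iff by blast+
  define l where "l = length \<Theta>"
  have l: "l < d"
    using \<Theta> complex_dim_link[OF \<Delta> v] d unfolding lsop_def l_def by simp
  have V: "vertices ?\<Gamma> \<subseteq> vertices \<Delta>" "v \<in> vertices \<Delta>" "v \<notin> vertices ?\<Gamma>"
    using v by (auto simp: vertices_def link_def)
  \<comment> \<open>Since \<open>l < d\<close>, the index \<open>l\<close> of the variable of
    \<open>v\<close> and the index \<open>d\<close> of \<omega> are distinct and both lie outside
    the range of \<Theta>.\<close>
  define L where "L j = (if j < l then \<Theta> ! j else if j = d then \<omega> else if j = l then indet v else 0)" for j
  have "L j \<in> homogeneous (vertices \<Delta>) 1" for j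
  proof -
    have "\<Theta> ! j \<in> homogeneous (vertices ?\<Gamma>) 1" if "j < l"
      using \<Theta> that nth_mem unfolding lsop_def l_def by blast
    then show ?thesis
      unfolding L_def using \<omega> homogeneous_mono[OF V(1)] indet_homogeneous[OF V(2)] homogeneous_0 by auto
  qed
  moreover have "spans {..d} L ?S"
    unfolding spans_def
  proof
    fix m assume m: "m \<in> ?S"
    show "\<exists>h. \<forall>s'\<in>?S. Poly_Mapping.lookup (\<Sum>j\<in>{..d}. L j * h j) s' = (if m = s' then 1 else 0)"
    proof (cases "v \<in> Poly_Mapping.keys m")
      case True
      \<comment> \<open>A monomial divisible by the variable of \<open>v\<close> is a multiple of
        the form at index \<open>l\<close>.\<close>
      have "m = Poly_Mapping.single v 1 + (m - Poly_Mapping.single v 1)"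
        using True
        by (intro poly_mapping_eqI) (auto simp: lookup_add lookup_minus lookup_single when_def in_keys_iff)
      then have "Poly_Mapping.single m 1 = indet v * Poly_Mapping.single (m - Poly_Mapping.single v 1) (1::'k)"
        by (simp add: indet_def mult_single)
      moreover have "(\<Sum>j\<le>d. L j * (if j = l then Poly_Mapping.single (m - Poly_Mapping.single v 1) 1 else 0))
          = (\<Sum>j\<le>d. if j = l then indet v * Poly_Mapping.single (m - Poly_Mapping.single v 1) 1 else 0)"
        using l by (intro sum.cong) (auto simp: L_def)
      ultimately have "(\<Sum>j\<le>d. L j * (if j = l then Poly_Mapping.single (m - Poly_Mapping.single v 1) 1 else 0))
          = Poly_Mapping.single m 1"
        using l by simp
      then show ?thesis
        by (intro exI[of _ "\<lambda>j. if j = l then Poly_Mapping.single (m - Poly_Mapping.single v 1) 1 else 0"])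
          (auto simp: lookup_single when_def)
    next
      case False
      \<comment> \<open>A monomial without \<open>v\<close> lives on the link, where surjectivity of
        \<omega> expresses it through \<omega> and \<Theta> up to an element \<open>p\<close> of the
        face ideal.\<close>
      then have "Poly_Mapping.keys m \<in> ?\<Gamma>" using m by (simp add: link_def)
      then have "Poly_Mapping.single m 1 \<in> homogeneous (vertices ?\<Gamma>) (i + 1)"
        using m by (intro homogeneous_single) (auto simp: vertices_def)
      then obtain g h p where *: "Poly_Mapping.single m 1 - \<omega> * g = (\<Sum>j<l. \<Theta> ! j * h j) + p"
        and p: "p \<in> face_ideal ?\<Gamma>"
        using surj unfolding lifted_param_ideal_def l_def by blast
      define h' where "h' j = (if j < l then h j else if j = d then g else 0)" for j
      have "(\<Sum>j<d. L j * h' j) = (\<Sum>j<l. L j * h' j)"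
        using l by (intro sum.mono_neutral_right) (auto simp: h'_def)
      also have "\<dots> = (\<Sum>j<l. \<Theta> ! j * h j)"
        by (intro sum.cong) (auto simp: h'_def L_def)
      finally have "(\<Sum>j\<le>d. L j * h' j) = (\<Sum>j<l. \<Theta> ! j * h j) + \<omega> * g"
        using l by (simp add: lessThan_Suc_atMost[symmetric] L_def h'_def)
      then have sum: "(\<Sum>j\<le>d. L j * h' j) = Poly_Mapping.single m 1 - p"
        using * by (simp add: algebra_simps)
      \<comment> \<open>The error \<open>p\<close> is invisible on the index set: its monomials
        avoid \<open>v\<close> and are not supported on faces of the link, whereas a monomial of the
        index set that avoids \<open>v\<close> is.\<close>
      have "Poly_Mapping.lookup p s' = 0" if s': "s' \<in> ?S" for s'
      proof (rule ccontr)
        assume "Poly_Mapping.lookup p s' \<noteq> 0"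
        then have "Poly_Mapping.keys s' \<subseteq> vertices ?\<Gamma>" "Poly_Mapping.keys s' \<notin> ?\<Gamma>"
          using p unfolding face_ideal_eq[OF \<Gamma>] nonface_polys_def by (simp_all add: polys_in_iff)
        then show False using s' V(3) by (auto simp: link_def)
      qed
      then show ?thesis
        by (intro exI[of _ h']) (auto simp: sum lookup_minus lookup_single when_def)
    qed
  qed
  ultimately show ?thesis by blast
qed

section \<open>The generic quotient\<close>

text \<open>The ideal that defines the ring A of the outline, taken in the polynomial ring on all
  variables. The forms 0 to \<open>d - 1\<close> will become \<Theta> and the form \<open>d\<close>
  will become \<omega>.\<close>

definition forms_ideal ::
  "'v set set \<Rightarrow> nat \<Rightarrow> (nat \<Rightarrow> ('v, 'k::field) mpoly) \<Rightarrow> ('v, 'k) mpoly set" where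
  "forms_ideal \<Delta> d L = {(\<Sum>j\<le>d. L j * h j) + p | h p. p \<in> nonface_polys \<Delta>}"

lemma forms_ideal_add:
  assumes "f \<in> forms_ideal \<Delta> d L" "g \<in> forms_ideal \<Delta> d L"
  shows "f + g \<in> forms_ideal \<Delta> d L"
proof -
  obtain h p h' p' where "f = (\<Sum>j\<le>d. L j * h j) + p" "p \<in> nonface_polys \<Delta>"
    "g = (\<Sum>j\<le>d. L j * h' j) + p'" "p' \<in> nonface_polys \<Delta>"
    using assms unfolding forms_ideal_def by blast
  then show ?thesis
    unfolding forms_ideal_def
    by (intro CollectI exI[of _ "\<lambda>j. h j + h' j"] exI[of _ "p + p'"])
      (simp add: nonface_polys_add distrib_left sum.distrib)
qed

lemma forms_ideal_mult:
  assumes "simplicial_complex \<Delta>" "f \<in> forms_ideal \<Delta> d L"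
  shows "x * f \<in> forms_ideal \<Delta> d L"
proof -
  obtain h p where "f = (\<Sum>j\<le>d. L j * h j) + p" "p \<in> nonface_polys \<Delta>"
    using assms(2) unfolding forms_ideal_def by blast
  then show ?thesis
    unfolding forms_ideal_def
    by (intro CollectI exI[of _ "\<lambda>j. x * h j"] exI[of _ "x * p"])
      (simp add: nonface_polys_mult[OF assms(1)] distrib_left sum_distrib_left mult.left_commute)
qed

lemma forms_ideal_combination: "(\<Sum>j\<le>d. L j * h j) \<in> forms_ideal \<Delta> d L"
  unfolding forms_ideal_def by (intro CollectI exI[of _ h] exI[of _ 0]) simp

lemma forms_ideal_nonface: "p \<in> nonface_polys \<Delta> \<Longrightarrow> p \<in> forms_ideal \<Delta> d L"
  unfolding forms_ideal_def by (intro CollectI exI[of _ "\<lambda>_. 0"] exI[of _ p]) simp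

lemma forms_ideal_sum:
  "(\<And>x. x \<in> A \<Longrightarrow> f x \<in> forms_ideal \<Delta> d L) \<Longrightarrow> (\<Sum>x\<in>A. f x) \<in> forms_ideal \<Delta> d L"
  by (induction A rule: infinite_finite_induct)
    (auto intro: forms_ideal_add forms_ideal_nonface)

text \<open>The forms are homogeneous of degree 1, so a graded piece of a combination is again a
  combination, with graded pieces as cofactors.\<close>

lemma component_combination:
  assumes "\<And>j. L j \<in> homogeneous V 1"
  shows "component V (Suc k) (\<Sum>j\<in>J. L j * h j) = (\<Sum>j\<in>J. L j * component V k (h j))"
  by (simp only: component_sum component_mult[OF assms])

lemma component_forms_ideal:
  assumes "\<And>j. L j \<in> homogeneous V 1"
  shows "component V (Suc k) (\<Sum>j\<le>d. L j * h j) \<in> forms_ideal \<Delta> d L"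
  unfolding component_combination[OF assms] by (rule forms_ideal_combination)

text \<open>Spanning yields an element \<open>P\<close> of the ideal that agrees with the monomial
  \<open>m\<close> on all monomials of the star of \<open>v\<close>. What remains becomes a sum of
  non-face monomials once multiplied by the variable of \<open>v\<close>.\<close>

lemma good_vertex_kills:
  fixes L :: "nat \<Rightarrow> ('v, 'k::field) mpoly"
  assumes \<Delta>: "simplicial_complex \<Delta>" and L: "\<And>j. L j \<in> homogeneous (vertices \<Delta>) 1"
    and v: "spans {..d} L {m. mdeg m = k + 1 \<and> insert v (Poly_Mapping.keys m) \<in> \<Delta>}"
    and m: "mdeg m = k + 1"
  shows "indet v * Poly_Mapping.single m 1 \<in> forms_ideal \<Delta> d L"
proof (cases "insert v (Poly_Mapping.keys m) \<in> \<Delta>")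
  case False
  have "indet v * Poly_Mapping.single m 1 = (Poly_Mapping.single (Poly_Mapping.single v 1 + m) 1 :: ('v, 'k) mpoly)"
    by (simp add: indet_def mult_single)
  then have "indet v * Poly_Mapping.single m 1 \<in> (nonface_polys \<Delta> :: ('v, 'k) mpoly set)"
    using False by (auto simp: nonface_polys_def lookup_single when_def keys_add_nat)
  then show ?thesis by (rule forms_ideal_nonface)
next
  case True
  let ?V = "vertices \<Delta>"
  obtain h where h: "\<And>s'. mdeg s' = k + 1 \<Longrightarrow> insert v (Poly_Mapping.keys s') \<in> \<Delta> \<Longrightarrow>
      Poly_Mapping.lookup (\<Sum>j\<le>d. L j * h j) s' = (if m = s' then 1 else 0)"
    using v m True unfolding spans_def by blast
  define P where "P = component ?V (Suc k) (\<Sum>j\<le>d. L j * h j)"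
  define q where "q = Poly_Mapping.single m 1 - P"
  have "Poly_Mapping.keys m \<subseteq> ?V" using True by (auto simp: vertices_def)
  then have q: "q \<in> homogeneous ?V (Suc k)"
    unfolding q_def P_def using m
    by (intro homogeneous_diff homogeneous_single component_homogeneous) auto
  have "indet v * q \<in> nonface_polys \<Delta>"
    unfolding nonface_polys_def
  proof (intro CollectI allI impI notI)
    fix n assume n: "Poly_Mapping.lookup (indet v * q) n \<noteq> 0" "Poly_Mapping.keys n \<in> \<Delta>"
    then obtain b where b: "n = Poly_Mapping.single v 1 + b" "Poly_Mapping.lookup q b \<noteq> 0"
      using keys_mult[of "indet v" q] by (auto simp: in_keys_iff indet_def lookup_single when_def split: if_splits)
    then have "mdeg b = k + 1" "Poly_Mapping.keys b \<subseteq> ?V"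
      using q by (simp_all add: homogeneous_iff)
    moreover have "insert v (Poly_Mapping.keys b) \<in> \<Delta>"
      using n(2) unfolding b(1) keys_add_nat by simp
    ultimately have "Poly_Mapping.lookup q b = 0"
      using h[of b] by (simp add: q_def P_def lookup_minus lookup_component lookup_single when_def)
    then show False using b(2) by contradiction
  qed
  moreover have "indet v * P \<in> forms_ideal \<Delta> d L"
    unfolding P_def by (intro forms_ideal_mult[OF \<Delta>] component_forms_ideal L)
  moreover have "indet v * Poly_Mapping.single m 1 = indet v * P + indet v * q"
    by (simp add: q_def algebra_simps)
  ultimately show ?thesis by (simp add: forms_ideal_add forms_ideal_nonface)
qed

text \<open>The forms \<open>L j\<close> express the variables in \<open>B\<close> through the remaining ones,
  each of which annihilates degree \<open>k + 1\<close>.\<close>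

lemma homogeneous_subset_forms_ideal:
  fixes L :: "nat \<Rightarrow> ('v, 'k::field) mpoly"
  assumes \<Delta>: "simplicial_complex \<Delta>" and L: "\<And>j. L j \<in> homogeneous (vertices \<Delta>) 1"
    and B: "B \<subseteq> vertices \<Delta>" "spans {..d} L ((\<lambda>u. Poly_Mapping.single u 1) ` B)"
    and good: "\<And>v. v \<in> vertices \<Delta> - B \<Longrightarrow>
      spans {..d} L {m. mdeg m = k + 1 \<and> insert v (Poly_Mapping.keys m) \<in> \<Delta>}"
  shows "homogeneous (vertices \<Delta>) (k + 2) \<subseteq> forms_ideal \<Delta> d L"
proof
  let ?V = "vertices \<Delta>"
  have var: "indet u * Poly_Mapping.single m 1 \<in> forms_ideal \<Delta> d L"
    if u: "u \<in> ?V" and m: "mdeg m = k + 1" for u m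
  proof (cases "u \<in> B")
    case False
    then show ?thesis using good_vertex_kills[OF \<Delta> L good m] u by blast
  next
    case True
    then obtain h where h: "\<And>w. w \<in> B \<Longrightarrow>
        Poly_Mapping.lookup (\<Sum>j\<le>d. L j * h j) (Poly_Mapping.single w 1)
        = (if Poly_Mapping.single u 1 = (Poly_Mapping.single w 1 :: 'v \<Rightarrow>\<^sub>0 nat) then 1 else 0)"
      using B(2) unfolding spans_def by blast
    \<comment> \<open>A linear form in the ideal with the same coefficients on \<open>B\<close> as
      the variable of \<open>u\<close>; the difference \<open>r\<close> therefore involves only
      vertices outside \<open>B\<close>.\<close>
    define P where "P = component ?V (Suc 0) (\<Sum>j\<le>d. L j * h j)"
    define r where "r = indet u - P"
    have r: "r \<in> homogeneous ?V 1"
      unfolding r_def P_def using indet_homogeneous[OF u] component_homogeneous[of ?V 1]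
      by (intro homogeneous_diff) auto
    have "Poly_Mapping.single n c * Poly_Mapping.single m 1 \<in> forms_ideal \<Delta> d L"
      if n: "n \<in> Poly_Mapping.keys r" for n c
    proof -
      have n': "mdeg n = 1" "Poly_Mapping.keys n \<subseteq> ?V"
        using r n by (auto simp: homogeneous_iff in_keys_iff)
      then obtain w where w: "n = Poly_Mapping.single w 1" using mdeg_1 by blast
      have "w \<in> ?V" using n'(2) unfolding w by simp
      moreover have "w \<notin> B"
      proof
        assume "w \<in> B"
        then have "Poly_Mapping.lookup r n = 0"
          unfolding w using h[of w] n'(2)
          by (simp add: r_def P_def lookup_minus lookup_component indet_def w lookup_single when_def)
        then show False using n by (simp add: in_keys_iff)
      qed
      ultimately have "indet w * Poly_Mapping.single m 1 \<in> forms_ideal \<Delta> d L"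
        using good_vertex_kills[OF \<Delta> L good m] by blast
      then have "Poly_Mapping.single 0 c * (indet w * Poly_Mapping.single m 1) \<in> forms_ideal \<Delta> d L"
        by (rule forms_ideal_mult[OF \<Delta>])
      then show ?thesis by (simp add: w indet_def mult_single)
    qed
    then have "(\<Sum>n\<in>Poly_Mapping.keys r. Poly_Mapping.single n (Poly_Mapping.lookup r n) * Poly_Mapping.single m 1)
        \<in> forms_ideal \<Delta> d L"
      by (rule forms_ideal_sum)
    then have "r * Poly_Mapping.single m 1 \<in> forms_ideal \<Delta> d L"
      by (simp only: sum_distrib_right[symmetric] sum_monomials[symmetric])
    moreover have "Poly_Mapping.single m 1 * P \<in> forms_ideal \<Delta> d L"
      unfolding P_def by (intro forms_ideal_mult[OF \<Delta>] component_forms_ideal L)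
    moreover have "indet u * Poly_Mapping.single m 1 =
        r * Poly_Mapping.single m 1 + Poly_Mapping.single m 1 * P"
      by (simp add: r_def algebra_simps)
    ultimately show ?thesis by (simp add: forms_ideal_add)
  qed
  fix f :: "('v, 'k) mpoly" assume f: "f \<in> homogeneous ?V (k + 2)"
  \<comment> \<open>Each monomial of degree \<open>k + 2\<close> is a variable times a monomial of
    degree \<open>k + 1\<close>, so \<open>var\<close> applies.\<close>
  have "Poly_Mapping.single n c \<in> forms_ideal \<Delta> d L"
    if n: "n \<in> Poly_Mapping.keys f" for n c
  proof -
    have n': "mdeg n = Suc (k + 1)" "Poly_Mapping.keys n \<subseteq> ?V"
      using f n by (auto simp: homogeneous_iff in_keys_iff)
    obtain u m where um: "n = Poly_Mapping.single u 1 + m" "mdeg m = k + 1"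
      using mdeg_Suc_split[OF n'(1)] by blast
    have "u \<in> ?V" using n'(2) unfolding um(1) keys_add_nat by simp
    then have "Poly_Mapping.single 0 c * (indet u * Poly_Mapping.single m 1) \<in> forms_ideal \<Delta> d L"
      by (intro forms_ideal_mult[OF \<Delta>] var um(2))
    then show ?thesis by (simp add: um(1) indet_def mult_single)
  qed
  then have "(\<Sum>n\<in>Poly_Mapping.keys f. Poly_Mapping.single n (Poly_Mapping.lookup f n)) \<in> forms_ideal \<Delta> d L"
    by (rule forms_ideal_sum)
  then show "f \<in> forms_ideal \<Delta> d L" by (simp only: sum_monomials[symmetric])
qed

section \<open>From spanning forms to an l.s.o.p. and a surjective multiplication\<close>

text \<open>A linear form has no constant term, so only the constant term of \<open>h\<close>
  reaches degree 1. On variables, \<open>spans\<close> is thereby a statement about the coefficient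
  matrix alone.\<close>

lemma lookup_linear_mult:
  assumes "l \<in> homogeneous V 1" "u \<in> V"
  shows "Poly_Mapping.lookup (l * h) (Poly_Mapping.single u 1) =
    Poly_Mapping.lookup h 0 * Poly_Mapping.lookup l (Poly_Mapping.single u 1)"
proof -
  have "component V 0 h = Poly_Mapping.single 0 (Poly_Mapping.lookup h 0)"
  proof (rule poly_mapping_eqI)
    fix m show "Poly_Mapping.lookup (component V 0 h) m =
        Poly_Mapping.lookup (Poly_Mapping.single 0 (Poly_Mapping.lookup h 0)) m"
      by (cases "m = 0") (auto simp: lookup_component lookup_single when_def mdeg_def[of 0] dest: mdeg_0)
  qed
  then have "component V (Suc 0) (l * h) = Poly_Mapping.single 0 (Poly_Mapping.lookup h 0) * l"
    using component_mult[OF assms(1), of 0 h] by (simp add: mult.commute)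
  moreover have "Poly_Mapping.lookup (l * h) (Poly_Mapping.single u 1) =
      Poly_Mapping.lookup (component V (Suc 0) (l * h)) (Poly_Mapping.single u 1)"
    using assms(2) by (simp add: lookup_component)
  ultimately show ?thesis by (simp only: lookup_const_mult)
qed

lemma rank_coeff_matrix:
  fixes \<Theta> :: "('v::linorder, 'k::field) mpoly list"
  assumes "finite \<sigma>" "card \<sigma> = length \<Theta>" "\<sigma> \<subseteq> V"
    and \<Theta>: "\<And>j. j < length \<Theta> \<Longrightarrow> \<Theta> ! j = L j" and L: "\<And>j. L j \<in> homogeneous V 1"
    and spans: "spans {..<length \<Theta>} L ((\<lambda>u. Poly_Mapping.single u 1) ` \<sigma>)"
  shows "vec_space.rank (length \<Theta>) (coeff_matrix \<Theta> \<sigma>) = length \<Theta>"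
proof -
  define d where "d = length \<Theta>"
  define w where "w = (\<lambda>j. sorted_list_of_set \<sigma> ! j)"
  have w: "w j \<in> \<sigma>" if "j < d" for j
    using that assms(1,2) nth_mem[of j "sorted_list_of_set \<sigma>"] by (simp add: w_def d_def)
  have w_inj: "w i = w j \<longleftrightarrow> i = j" if "i < d" "j < d" for i j
    using that assms(1,2) nth_eq_iff_index_eq[of "sorted_list_of_set \<sigma>" i j] by (simp add: w_def d_def)
  have single_eq: "Poly_Mapping.single u 1 = (Poly_Mapping.single u' 1 :: 'v \<Rightarrow>\<^sub>0 nat) \<longleftrightarrow> u = u'" for u u'
    using keys_single[of u "1::nat"] keys_single[of u' "1::nat"] by (metis one_neq_zero singleton_inject)
  have "\<forall>u\<in>\<sigma>. \<exists>h. \<forall>u'\<in>\<sigma>. Poly_Mapping.lookup (\<Sum>j<d. L j * h j) (Poly_Mapping.single u' 1)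
      = (if u = u' then 1 else 0)"
    using spans unfolding spans_def ball_simps single_eq d_def .
  then obtain h where h: "\<And>u u'. u \<in> \<sigma> \<Longrightarrow> u' \<in> \<sigma> \<Longrightarrow>
      Poly_Mapping.lookup (\<Sum>j<d. L j * h u j) (Poly_Mapping.single u' 1) = (if u = u' then 1 else 0)"
    by metis
  define A where "A = coeff_matrix \<Theta> \<sigma>"
  \<comment> \<open>The constant terms of the cofactors form a left inverse of the coefficient
    matrix, whose determinant is then nonzero.\<close>
  define C where "C = mat d d (\<lambda>(i, j). Poly_Mapping.lookup (h (w i) j) 0)"
  have A: "A \<in> carrier_mat d d" and C: "C \<in> carrier_mat d d"
    by (simp_all add: A_def coeff_matrix_def C_def d_def assms(2))
  have "C * A = 1\<^sub>m d"
  proof (rule eq_matI)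
    fix i k assume "i < dim_row (1\<^sub>m d :: 'k mat)" "k < dim_col (1\<^sub>m d :: 'k mat)"
    then have ik: "i < d" "k < d" by auto
    have "(C * A) $$ (i, k) =
        (\<Sum>j<d. Poly_Mapping.lookup (h (w i) j) 0 * Poly_Mapping.lookup (L j) (Poly_Mapping.single (w k) 1))"
      using ik A C \<Theta>
      by (simp add: scalar_prod_def lessThan_atLeast0 C_def A_def coeff_matrix_def d_def assms(2) w_def)
    also have "\<dots> = Poly_Mapping.lookup (\<Sum>j<d. L j * h (w i) j) (Poly_Mapping.single (w k) 1)"
      using w[OF ik(2)] assms(3) by (simp only: lookup_sum lookup_linear_mult[OF L subsetD])
    also have "\<dots> = (if i = k then 1 else 0)"
      using h[OF w w] w_inj ik by simp
    finally show "(C * A) $$ (i, k) = 1\<^sub>m d $$ (i, k)" using ik by simp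
  qed (use A C in auto)
  then have "det C * det A = 1" using det_mult[OF C A] by simp
  then have "det A \<noteq> 0" by force
  then show ?thesis using vec_space.det_rank_iff[OF A] by (simp add: A_def d_def)
qed

text \<open>If every polynomial of degree \<open>k + 1\<close> is a combination of the
  \<open>d + 1\<close> forms modulo non-faces, the summand of index \<open>d\<close> is the required
  multiple of \<omega> and the other summands lie in the ideal of \<Theta>.\<close>

lemma L_s_generic:
  fixes \<Delta> :: "'v::linorder set set" and L :: "nat \<Rightarrow> ('v, 'k::field) mpoly"
  assumes \<Delta>: "simplicial_complex \<Delta>" and L: "\<And>j. L j \<in> homogeneous (vertices \<Delta>) 1"
    and d: "complex_dim \<Delta> = int d - 1"
    and facets: "\<And>\<sigma>. \<sigma> \<in> facets \<Delta> \<Longrightarrow> card \<sigma> = d \<and>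
      spans {..<d} L ((\<lambda>u. Poly_Mapping.single u 1) ` \<sigma>)"
    and generic: "homogeneous (vertices \<Delta>) (k + 1) \<subseteq> forms_ideal \<Delta> d L"
  shows "(L d, map L [0..<d]) \<in> L_s k \<Delta>"
  unfolding L_s_iff
proof (intro conjI ballI)
  let ?V = "vertices \<Delta>" and ?\<Theta> = "map L [0..<d]"
  show "L d \<in> homogeneous ?V 1" by (rule L)
  have "vec_space.rank (length ?\<Theta>) (coeff_matrix ?\<Theta> \<sigma>) = length ?\<Theta>" if "\<sigma> \<in> facets \<Delta>" for \<sigma>
  proof (rule rank_coeff_matrix[where V = ?V and L = L])
    show "finite \<sigma>" "\<sigma> \<subseteq> ?V"
      using that \<Delta> by (auto simp: facets_def simplicial_complex_def vertices_def)
  qed (use facets[OF that] L in auto)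
  then show "lsop \<Delta> ?\<Theta>"
    unfolding lsop_def using d L by auto
  fix f :: "('v, 'k) mpoly" assume f: "f \<in> homogeneous ?V (k + 1)"
  then obtain h p where hp: "f = (\<Sum>j\<le>d. L j * h j) + p" "p \<in> nonface_polys \<Delta>"
    using generic unfolding forms_ideal_def by blast
  \<comment> \<open>Passing to components gives the cofactor of \<omega> degree \<open>k\<close> and
    puts all cofactors and the error term into the polynomial ring on the vertices.\<close>
  define h' where "h' j = component ?V k (h j)" for j
  define p' where "p' = component ?V (Suc k) p"
  have hom: "h' j \<in> homogeneous ?V k" "p' \<in> homogeneous ?V (Suc k)" for j
    unfolding h'_def p'_def by (rule component_homogeneous)+
  have "f = component ?V (Suc k) ((\<Sum>j\<le>d. L j * h j) + p)"
    using component_id[OF f] hp(1) by simp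
  also have "\<dots> = (\<Sum>j\<le>d. L j * h' j) + p'"
    by (simp only: component_add component_combination[OF L] h'_def p'_def)
  finally have "f - L d * h' d = (\<Sum>j<d. L j * h' j) + p'"
    by (simp add: lessThan_Suc_atMost[symmetric])
  also have "(\<Sum>j<d. L j * h' j) = (\<Sum>j<length ?\<Theta>. ?\<Theta> ! j * h' j)"
    by simp
  finally have "f - L d * h' d = (\<Sum>j<length ?\<Theta>. ?\<Theta> ! j * h' j) + p'" .
  moreover have "p' \<in> face_ideal \<Delta>"
    unfolding face_ideal_eq[OF \<Delta>] using hom(2) hp(2) homogeneous_subset_polys_in
    by (auto simp: p'_def nonface_polys_def lookup_component)
  moreover have "\<forall>j. h' j \<in> polys_in ?V"
    using hom(1) homogeneous_subset_polys_in by blast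
  ultimately have "f - L d * h' d \<in> lifted_param_ideal \<Delta> ?\<Theta>"
    unfolding lifted_param_ideal_def by blast
  then show "\<exists>g\<in>homogeneous ?V k. f - L d * g \<in> lifted_param_ideal \<Delta> ?\<Theta>"
    using hom(1) by blast
qed

section \<open>Choosing one system of forms for all conditions\<close>

theorem theorem4p26:
  fixes \<Delta> :: "'v::linorder set set" and d n i :: nat
  assumes "infinite (UNIV :: 'k::field set)"
    and "simplicial_complex \<Delta>"
    and "connected_complex \<Delta>"
    and "pure_complex \<Delta>"
    and "complex_dim \<Delta> = int d - 1"
    and "homology_manifold TYPE('k) \<Delta>"
    and "d \<ge> 4"
    and "card (vertices \<Delta>) = n"
    and "card {v \<in> vertices \<Delta>.
           (L_s i (link \<Delta> {v}) :: (('v, 'k) mpoly \<times> ('v, 'k) mpoly list) set) \<noteq> {}} \<ge> n - d"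
  shows "(L_s (i + 1) \<Delta> :: (('v, 'k) mpoly \<times> ('v, 'k) mpoly list) set) \<noteq> {}"
proof -
  note \<Delta> = assms(2)
  let ?V = "vertices \<Delta>"
  let ?X = "\<lambda>\<sigma>. (\<lambda>u. Poly_Mapping.single u (1::nat)) ` \<sigma> :: ('v \<Rightarrow>\<^sub>0 nat) set"
  let ?S = "\<lambda>v. {m. mdeg m = i + 1 \<and> insert v (Poly_Mapping.keys m) \<in> \<Delta>}"
  define G where "G = {v \<in> ?V. (L_s i (link \<Delta> {v}) :: (('v, 'k) mpoly \<times> ('v, 'k) mpoly list) set) \<noteq> {}}"
  define B where "B = ?V - G"
  have fin: "finite ?V" using finite_vertices[OF \<Delta>] .
  have "G \<subseteq> ?V" by (auto simp: G_def)
  \<comment> \<open>At most \<open>d\<close> vertices are exceptional. The bound survives the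
    truncated subtraction \<open>n - d\<close>: for \<open>n < d\<close> all vertices together
    number at most \<open>d\<close>.\<close>
  then have "card B = n - card G"
    unfolding B_def using fin assms(8) by (simp add: card_Diff_subset finite_subset)
  then have cardB: "card B \<le> d" using assms(9) unfolding G_def by linarith
  have facet: "finite \<sigma>" "\<sigma> \<subseteq> ?V" "card \<sigma> = d" if "\<sigma> \<in> facets \<Delta>" for \<sigma>
    using that \<Delta> assms(4,5)
    by (auto simp: facets_def simplicial_complex_def vertices_def pure_complex_def)
  have face: "{v} \<in> \<Delta>" if "v \<in> ?V" for v
    using that \<Delta> by (auto simp: vertices_def simplicial_complex_def)
  \<comment> \<open>Pairs of an index set and a monomial set. Facets involve only the first
    \<open>d\<close> forms, since \<omega> is not part of the l.s.o.p.; the exceptional vertices and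
    the stars of the good vertices may use all \<open>d + 1\<close> forms.\<close>
  define conds where "conds = (\<lambda>\<sigma>. ({..<d}, ?X \<sigma>)) ` facets \<Delta> \<union> {({..d}, ?X B)} \<union> (\<lambda>v. ({..d}, ?S v)) ` G"
  have "\<exists>L :: nat \<Rightarrow> ('v, 'k) mpoly. (\<forall>j. L j \<in> homogeneous ?V 1) \<and> spans (fst a) L (snd a)"
    if "a \<in> conds" for a
  proof -
    have "\<exists>L :: nat \<Rightarrow> ('v, 'k) mpoly. (\<forall>j. L j \<in> homogeneous ?V 1) \<and> spans {..<d} L (?X \<sigma>)"
      if "\<sigma> \<in> facets \<Delta>" for \<sigma>
      by (rule spans_variables) (use facet[OF that] in auto)
    moreover have "\<exists>L :: nat \<Rightarrow> ('v, 'k) mpoly. (\<forall>j. L j \<in> homogeneous ?V 1) \<and> spans {..d} L (?X B)"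
      by (rule spans_variables) (use fin cardB in \<open>auto simp: B_def\<close>)
    moreover have "\<exists>L :: nat \<Rightarrow> ('v, 'k) mpoly. (\<forall>j. L j \<in> homogeneous ?V 1) \<and> spans {..d} L (?S v)"
      if "v \<in> G" for v
      by (rule spans_star[OF \<Delta> face assms(5)]) (use that in \<open>auto simp: G_def\<close>)
    ultimately show ?thesis using that unfolding conds_def by auto
  qed
  then obtain L :: "_ \<Rightarrow> nat \<Rightarrow> ('v, 'k) mpoly" where L: "\<And>a j. a \<in> conds \<Longrightarrow> L a j \<in> homogeneous ?V 1"
    "\<And>a. a \<in> conds \<Longrightarrow> spans (fst a) (L a) (snd a)"
    by metis
  have "finite (facets \<Delta>)" using \<Delta> by (simp add: facets_def simplicial_complex_def)
  then have "finite conds" unfolding conds_def using \<open>G \<subseteq> ?V\<close> fin finite_subset by blast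
  moreover have "finite (?S v)" for v
    by (rule finite_subset[OF _ finite_monomials[OF fin, of "i + 1"]]) (auto simp: vertices_def)
  then have "finite (snd a)" if "a \<in> conds" for a
    using that facet(1) fin unfolding conds_def by (auto simp: B_def)
  ultimately obtain M :: "nat \<Rightarrow> ('v, 'k) mpoly" where "\<forall>j. M j \<in> homogeneous ?V 1"
    and conds: "\<forall>a\<in>conds. spans (fst a) M (snd a)"
    using spans_simultaneously[OF assms(1), of conds snd L ?V fst] L by blast
  then have M: "\<And>j. M j \<in> homogeneous ?V 1" by blast
  have Mf: "spans {..<d} M (?X \<sigma>)" if "\<sigma> \<in> facets \<Delta>" for \<sigma>
    using bspec[OF conds, of "({..<d}, ?X \<sigma>)"] that unfolding conds_def by simp
  have MB: "spans {..d} M (?X B)"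
    using bspec[OF conds, of "({..d}, ?X B)"] unfolding conds_def by simp
  have MG: "spans {..d} M (?S v)" if "v \<in> G" for v
    using bspec[OF conds, of "({..d}, ?S v)"] that unfolding conds_def by simp
  \<comment> \<open>The good vertices annihilate degree \<open>i + 1\<close>, so everything vanishes
    one degree higher. Degree \<open>i + 2\<close> is exactly the target of the multiplication in
    \<open>L_s (i + 1)\<close>.\<close>
  have "homogeneous ?V (i + 2) \<subseteq> forms_ideal \<Delta> d M"
    by (rule homogeneous_subset_forms_ideal[OF \<Delta> M _ MB])
      (use MG in \<open>auto simp: B_def\<close>)
  then have "(M d, map M [0..<d]) \<in> L_s (i + 1) \<Delta>"
    using facet(3) Mf by (intro L_s_generic[OF \<Delta> M assms(5)]) auto
  then show ?thesis by blast
qed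

end
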